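(* For each $n\ge 1$, $$R_n\cong R_n/J_n\otimes \mathrm{Sym}_{R_n}$$ as an algebra. That is, $R_n$ is free over $\mathrm{Sym}_{R_n}$.
   Context: Let $R_n=\mathbb{Q}[\theta_1,\dots,\theta_n]$ be the polynomial ring in anticommuting variables over $\mathbb{Q}$ (isomorphic to the exterior algebra of a vector space of dimension $n$): $\theta_i\theta_j=-\theta_j\theta_i$ for $i\ne j$ and $\theta_i^2=0$, graded by degree. The symmetric group $\mathcal{S}_n$ acts on $R_n$ by permuting the variables; $\mathrm{Sym}_{R_n}$ is the ring of symmetric invariants of $R_n$, which has linear basis $\{1,F_1\}$ with $F_1=\theta_1+\theta_2+\cdots+\theta_n$. $J_n$ is the ideal of $R_n$ generated by the symmetric invariants of non-zero degree, i.e. the ideal generated by $F_1$. The symbol $\otimes$ denotes tensor product over $\mathbb{Q}$. *)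

theory Defs
  imports Complex_Main "HOL-Library.Poly_Mapping" "HOL-Combinatorics.Permutations"
    "HOL-Algebra.QuotRing" "HOL-Algebra.Module"
begin

section \<open>Graded algebras over the rationals\<close>

text \<open>\<open>hcomp A d x\<close> is the homogeneous component of degree \<open>d\<close> of \<open>x\<close>.\<close>

record 'a graded_alg = "(rat, 'a) module" +
  hcomp :: "nat \<Rightarrow> 'a \<Rightarrow> 'a"

definition quot_alg :: "(rat, 'a, 'm) module_scheme \<Rightarrow> 'a set \<Rightarrow> (rat, 'a set) module" where
  "quot_alg A I =
    \<lparr>carrier = carrier (A Quot I), mult = mult (A Quot I), one = one (A Quot I),
     zero = zero (A Quot I), add = add (A Quot I),
     smult = (\<lambda>q X. \<Union>x\<in>X. I +>\<^bsub>A\<^esub> (q \<odot>\<^bsub>A\<^esub> x))\<rparr>"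

text \<open>The induced grading, meaningful when \<open>I\<close> is a homogeneous ideal.\<close>

definition graded_quot :: "('a, 'm) graded_alg_scheme \<Rightarrow> 'a set \<Rightarrow> 'a set graded_alg" where
  "graded_quot A I =
    module.extend (quot_alg A I) \<lparr>hcomp = (\<lambda>d X. \<Union>x\<in>X. I +>\<^bsub>A\<^esub> hcomp A d x)\<rparr>"

definition alg_iso ::
  "(rat, 'a, 'm) module_scheme \<Rightarrow> (rat, 'b, 'n) module_scheme \<Rightarrow> ('a \<Rightarrow> 'b) set" where
  "alg_iso A B =
    {h \<in> ring_iso A B. \<forall>q. \<forall>x\<in>carrier A. h (q \<odot>\<^bsub>A\<^esub> x) = q \<odot>\<^bsub>B\<^esub> h x}"

definition alg_isomorphic ::
  "(rat, 'a, 'm) module_scheme \<Rightarrow> (rat, 'b, 'n) module_scheme \<Rightarrow> bool"  (infix \<open>\<cong>\<^sub>a\<close> 50) where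
  "A \<cong>\<^sub>a B \<longleftrightarrow> alg_iso A B \<noteq> {}"


section \<open>Tensor product of graded algebras over the rationals\<close>

text \<open>
  The vector space \<open>A \<otimes> B\<close> is the quotient of the free vector space on
  \<open>carrier A \<times> carrier B\<close> by the span of the bilinearity relations.
\<close>

definition free_scale :: "rat \<Rightarrow> ('a \<Rightarrow>\<^sub>0 rat) \<Rightarrow> ('a \<Rightarrow>\<^sub>0 rat)" where
  "free_scale q x = Poly_Mapping.map ((*) q) x"

lemma lookup_free_scale:
  "Poly_Mapping.lookup (free_scale q x) p = q * Poly_Mapping.lookup x p"
  by (simp add: free_scale_def Poly_Mapping.map.rep_eq when_def)

interpretation free_space: vector_space free_scale
  by unfold_locales
    (auto simp: poly_mapping_eq_iff fun_eq_iff lookup_add lookup_free_scale algebra_simps)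

definition bilinear_rels ::
  "(rat, 'a, 'm) module_scheme \<Rightarrow> (rat, 'b, 'n) module_scheme \<Rightarrow> (('a \<times> 'b) \<Rightarrow>\<^sub>0 rat) set" where
  "bilinear_rels A B =
    {Poly_Mapping.single (a \<oplus>\<^bsub>A\<^esub> a', b) 1 - Poly_Mapping.single (a, b) 1
        - Poly_Mapping.single (a', b) 1 | a a' b.
        a \<in> carrier A \<and> a' \<in> carrier A \<and> b \<in> carrier B} \<union>
    {Poly_Mapping.single (a, b \<oplus>\<^bsub>B\<^esub> b') 1 - Poly_Mapping.single (a, b) 1
        - Poly_Mapping.single (a, b') 1 | a b b'.
        a \<in> carrier A \<and> b \<in> carrier B \<and> b' \<in> carrier B} \<union>
    {Poly_Mapping.single (q \<odot>\<^bsub>A\<^esub> a, b) 1 - free_scale q (Poly_Mapping.single (a, b) 1) | q a b.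
        a \<in> carrier A \<and> b \<in> carrier B} \<union>
    {Poly_Mapping.single (a, q \<odot>\<^bsub>B\<^esub> b) 1 - free_scale q (Poly_Mapping.single (a, b) 1) | q a b.
        a \<in> carrier A \<and> b \<in> carrier B}"

text \<open>
  The product is that of the tensor product of graded algebras, with the Koszul sign
  \<open>(a \<otimes> b)(a' \<otimes> b') = (-1)\<^bsup>|b||a'|\<^esup> aa' \<otimes> bb'\<close> for homogeneous \<open>b\<close>, \<open>a'\<close>,
  as needed for anticommuting variables: without the sign, the tensor product of two
  exterior algebras on one generator is commutative, hence not the exterior algebra on two
  generators.  For arbitrary \<open>b\<close> and \<open>a'\<close> the product is obtained by splitting them
  into homogeneous components.
\<close>

definition koszul_mult ::
  "('a, 'm) graded_alg_scheme \<Rightarrow> ('b, 'n) graded_alg_scheme \<Rightarrow>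
   'a \<times> 'b \<Rightarrow> 'a \<times> 'b \<Rightarrow> (('a \<times> 'b) \<Rightarrow>\<^sub>0 rat)" where
  "koszul_mult A B = (\<lambda>(a, b) (a', b').
    \<Sum>i | hcomp A i a' \<noteq> \<zero>\<^bsub>A\<^esub>. \<Sum>j | hcomp B j b \<noteq> \<zero>\<^bsub>B\<^esub>.
      Poly_Mapping.single (a \<otimes>\<^bsub>A\<^esub> hcomp A i a', hcomp B j b \<otimes>\<^bsub>B\<^esub> b') ((-1) ^ (i * j)))"

text \<open>
  The bilinear extension of \<open>koszul_mult\<close> to the free vector space.  This product need not be
  associative; it becomes so modulo the bilinearity relations.
\<close>

definition pre_tensor ::
  "('a, 'm) graded_alg_scheme \<Rightarrow> ('b, 'n) graded_alg_scheme \<Rightarrow>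
   (rat, ('a \<times> 'b) \<Rightarrow>\<^sub>0 rat) module" where
  "pre_tensor A B =
    \<lparr>carrier = {x. Poly_Mapping.keys x \<subseteq> carrier A \<times> carrier B},
     mult = (\<lambda>x y. \<Sum>p\<in>Poly_Mapping.keys x. \<Sum>p'\<in>Poly_Mapping.keys y.
       free_scale (Poly_Mapping.lookup x p * Poly_Mapping.lookup y p') (koszul_mult A B p p')),
     one = Poly_Mapping.single (\<one>\<^bsub>A\<^esub>, \<one>\<^bsub>B\<^esub>) 1,
     zero = 0, add = (+), smult = free_scale\<rparr>"

definition tensor_alg ::
  "('a, 'm) graded_alg_scheme \<Rightarrow> ('b, 'n) graded_alg_scheme \<Rightarrow>
   (rat, (('a \<times> 'b) \<Rightarrow>\<^sub>0 rat) set) module"  (infixl \<open>\<otimes>\<^sub>\<rat>\<close> 70) where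
  "A \<otimes>\<^sub>\<rat> B = quot_alg (pre_tensor A B) (free_space.span (bilinear_rels A B))"


section \<open>Free modules\<close>

definition is_basis :: "('r, 'k) ring_scheme \<Rightarrow> ('r, 'a, 'm) module_scheme \<Rightarrow> 'a set \<Rightarrow> bool" where
  "is_basis R M B \<longleftrightarrow> B \<subseteq> carrier M \<and>
    (\<forall>x\<in>carrier M. \<exists>!c.
      (\<forall>b\<in>B. c b \<in> carrier R) \<and> (\<forall>b. b \<notin> B \<longrightarrow> c b = \<zero>\<^bsub>R\<^esub>) \<and>
      finite {b \<in> B. c b \<noteq> \<zero>\<^bsub>R\<^esub>} \<and>
      x = (\<Oplus>\<^bsub>M\<^esub>b\<in>{b \<in> B. c b \<noteq> \<zero>\<^bsub>R\<^esub>}. c b \<odot>\<^bsub>M\<^esub> b))"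

definition free_module :: "('r, 'k) ring_scheme \<Rightarrow> ('r, 'a, 'm) module_scheme \<Rightarrow> bool" where
  "free_module R M \<longleftrightarrow> module R M \<and> (\<exists>B. is_basis R M B)"

text \<open>A ring as a left module over its subrings.\<close>

definition left_regular :: "('a, 'm) ring_scheme \<Rightarrow> ('a, 'a) module" where
  "left_regular R =
    \<lparr>carrier = carrier R, mult = mult R, one = one R, zero = zero R, add = add R,
     smult = mult R\<rparr>"


section \<open>Polynomials in anticommuting variables\<close>

text \<open>
  A polynomial in \<open>\<theta>\<^sub>1, \<dots>, \<theta>\<^sub>n\<close> is given by its coefficients: \<open>f S\<close> is the coefficient of the
  monomial \<open>\<theta>\<^sub>S\<close>, the product of the \<open>\<theta>\<^sub>i\<close> with \<open>i \<in> S\<close> in increasing order of \<open>i\<close>.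
  Sorting the product \<open>\<theta>\<^sub>S \<theta>\<^sub>T\<close> of monomials with disjoint \<open>S\<close> and \<open>T\<close> into increasing order
  yields \<open>shuffle_sign S T\<close> times \<open>\<theta>\<close> indexed by \<open>S \<union> T\<close>.
\<close>

type_synonym anti_poly = "nat set \<Rightarrow> rat"

definition shuffle_sign :: "nat set \<Rightarrow> nat set \<Rightarrow> rat" where
  "shuffle_sign S T = (-1) ^ card {(s, t). s \<in> S \<and> t \<in> T \<and> t < s}"

definition anti_ring :: "nat \<Rightarrow> anti_poly graded_alg" where
  "anti_ring n =
    \<lparr>carrier = {f. \<forall>S. \<not> S \<subseteq> {1..n} \<longrightarrow> f S = 0},
     mult = (\<lambda>f g U. \<Sum>S\<in>Pow U. shuffle_sign S (U - S) * f S * g (U - S)),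
     one = (\<lambda>S. if S = {} then 1 else 0),
     zero = (\<lambda>S. 0),
     add = (\<lambda>f g S. f S + g S),
     smult = (\<lambda>q f S. q * f S),
     hcomp = (\<lambda>d f S. if card S = d then f S else 0)\<rparr>"

definition theta :: "nat \<Rightarrow> anti_poly" where
  "theta i = (\<lambda>S. if S = {i} then 1 else 0)"

text \<open>
  The action of a permutation \<open>\<sigma>\<close> of \<open>{1..n}\<close> replaces each \<open>\<theta>\<^sub>i\<close> by \<open>\<theta>\<close> indexed by \<open>\<sigma> i\<close>
  in every monomial.
\<close>

definition perm_act :: "nat \<Rightarrow> (nat \<Rightarrow> nat) \<Rightarrow> anti_poly \<Rightarrow> anti_poly" where
  "perm_act n \<sigma> f = (\<lambda>U. \<Sum>S\<in>Pow {1..n}.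
    f S * foldr (mult (anti_ring n)) (map (\<lambda>i. theta (\<sigma> i)) (sorted_list_of_set S))
            \<one>\<^bsub>anti_ring n\<^esub> U)"

definition sym_ring :: "nat \<Rightarrow> anti_poly graded_alg" where
  "sym_ring n = (anti_ring n)
    \<lparr>carrier := {f \<in> carrier (anti_ring n). \<forall>\<sigma>. \<sigma> permutes {1..n} \<longrightarrow> perm_act n \<sigma> f = f}\<rparr>"

definition J_ideal :: "nat \<Rightarrow> anti_poly set" where
  "J_ideal n = Idl\<^bsub>anti_ring n\<^esub>
    {f \<in> carrier (sym_ring n). \<exists>d>0. hcomp (anti_ring n) d f = f}"

end

theory Submission
  imports Defs "HOL-Library.Function_Algebras"
begin

text \<open>
  Since \<open>\<theta>\<^sub>n\<close> equals \<open>F\<^sub>1\<close> minus the other variables, every \<open>x \<in> R\<^sub>n\<close> is \<open>g + h \<cdot> F\<^sub>1\<close> for unique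
  \<open>g, h \<in> R\<^sub>n\<^sub>-\<^sub>1\<close>.  As \<open>F\<^sub>1\<close> commutes with homogeneous elements up to sign and \<open>F\<^sub>1 \<cdot> F\<^sub>1 = 0\<close>, the map
  \<open>x \<mapsto> g\<close> is a ring homomorphism with kernel \<open>J\<^sub>n\<close>, so \<open>R\<^sub>n\<^sub>-\<^sub>1\<close> represents \<open>R\<^sub>n / J\<^sub>n\<close>, and
  \<open>[g] \<otimes> b \<mapsto> g \<cdot> b\<close> is multiplicative for the Koszul sign.  It is bijective because every tensor
  reduces to \<open>[g] \<otimes> 1 + [h] \<otimes> F\<^sub>1\<close>.  The monomials in \<open>\<theta>\<^sub>1, \<dots>, \<theta>\<^sub>n\<^sub>-\<^sub>1\<close> form a basis over the
  invariants.
\<close>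

text \<open>Both \<open>R_n / J_n\<close> and the tensor product are quotients whose elements are
  sets, and the product on \<open>pre_tensor\<close> need not be associative, so the theory of
  quotient rings does not apply to the second one. Both are therefore treated as quotients of an
  abelian group by the kernel of an additive map: their elements are the fibres of that map, and
  computing with fibres means computing with values. This requires the kernel to be known exactly,
  as \<open>J_n\<close> in one case and as the span of the bilinearity relations in the other; the
  splitting g + h F_1 settles both. \<open>F_1\<close> is kept on the right because the invariant is
  the right factor of a pure tensor. Scalars of the module act from the left, and changing sides is
  what brings in the twist by \<open>parity\<close>. The bound n >= 1 provides a last variable to
  eliminate, hence the index \<open>Suc m\<close>.\<close>

section \<open>Arithmetic of anticommuting polynomials\<close>

text \<open>As simp rules, these would also rewrite an unapplied \<open>f + g\<close> to \<open>\<lambda>x. f x + g x\<close>.\<close>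

declare plus_fun_apply [simp del] zero_fun_apply [simp del]
  minus_apply [simp del] uminus_apply [simp del]

lemmas pointwise = fun_eq_iff plus_fun_apply zero_fun_apply minus_apply uminus_apply

definition scale :: "rat \<Rightarrow> anti_poly \<Rightarrow> anti_poly"  (infixr \<open>*\<^sub>s\<close> 75) where
  "q *\<^sub>s f = (\<lambda>S. q * f S)"

definition wedge :: "anti_poly \<Rightarrow> anti_poly \<Rightarrow> anti_poly"  (infixl \<open>\<cdot>\<close> 70) where
  "f \<cdot> g = (\<lambda>U. \<Sum>S\<in>Pow U. shuffle_sign S (U - S) * f S * g (U - S))"

definition one_poly :: anti_poly  (\<open>\<one>\<^sub>\<theta>\<close>) where
  "\<one>\<^sub>\<theta> = (\<lambda>S. if S = {} then 1 else 0)"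

definition hom_comp :: "nat \<Rightarrow> anti_poly \<Rightarrow> anti_poly" where
  "hom_comp d f = (\<lambda>S. if card S = d then f S else 0)"

abbreviation poly_space :: "nat \<Rightarrow> anti_poly set" where
  "poly_space n \<equiv> carrier (anti_ring n)"

lemma anti_ring_simps [simp]:
  "mult (anti_ring n) = (\<cdot>)" "one (anti_ring n) = \<one>\<^sub>\<theta>" "zero (anti_ring n) = 0"
  "add (anti_ring n) = (+)" "smult (anti_ring n) = (*\<^sub>s)" "hcomp (anti_ring n) = hom_comp"
  by (auto simp: anti_ring_def wedge_def one_poly_def scale_def hom_comp_def pointwise)

lemma poly_space_iff: "f \<in> poly_space n \<longleftrightarrow> (\<forall>S. \<not> S \<subseteq> {1..n} \<longrightarrow> f S = 0)"
  by (simp add: anti_ring_def)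

lemma poly_spaceD: "f \<in> poly_space n \<Longrightarrow> \<not> S \<subseteq> {1..n} \<Longrightarrow> f S = 0"
  by (simp add: poly_space_iff)

section \<open>Signs of shuffled monomials\<close>

lemma shuffle_sign_Un_left:
  assumes "finite S" "finite T" "finite V" "S \<inter> T = {}"
  shows "shuffle_sign (S \<union> T) V = shuffle_sign S V * shuffle_sign T V"
proof -
  have eq: "{(s, t). s \<in> S \<union> T \<and> t \<in> V \<and> t < s}
     = {(s, t). s \<in> S \<and> t \<in> V \<and> t < s} \<union> {(s, t). s \<in> T \<and> t \<in> V \<and> t < s}"
    by auto
  have fin: "finite {(s, t). s \<in> A \<and> t \<in> V \<and> t < s}" if "finite A" for A
    by (rule finite_subset[of _ "A \<times> V"]) (use assms that in auto)
  show ?thesis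
    unfolding shuffle_sign_def eq
    using assms by (subst card_Un_disjoint) (auto intro: fin simp: power_add)
qed

lemma shuffle_sign_Un_right:
  assumes "finite S" "finite T" "finite V" "T \<inter> V = {}"
  shows "shuffle_sign S (T \<union> V) = shuffle_sign S T * shuffle_sign S V"
proof -
  have eq: "{(s, t). s \<in> S \<and> t \<in> T \<union> V \<and> t < s}
     = {(s, t). s \<in> S \<and> t \<in> T \<and> t < s} \<union> {(s, t). s \<in> S \<and> t \<in> V \<and> t < s}"
    by auto
  have fin: "finite {(s, t). s \<in> S \<and> t \<in> A \<and> t < s}" if "finite A" for A
    by (rule finite_subset[of _ "S \<times> A"]) (use assms that in auto)
  show ?thesis
    unfolding shuffle_sign_def eq
    using assms by (subst card_Un_disjoint) (auto intro: fin simp: power_add)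
qed

text \<open>By disjointness, every pair in \<open>S \<times> T\<close> is an inversion for exactly
  one of the two orders, so the two exponents add up to \<open>card S * card T\<close>.\<close>

lemma shuffle_sign_commute:
  assumes "finite S" "finite T" "S \<inter> T = {}"
  shows "shuffle_sign T S = (-1) ^ (card S * card T) * shuffle_sign S T"
proof -
  let ?A = "{(s, t). s \<in> S \<and> t \<in> T \<and> t < s}" and ?B = "{(t, s). t \<in> T \<and> s \<in> S \<and> s < t}"
  have fin: "finite ?A" "finite ?B"
    by (rule finite_subset[of _ "S \<times> T"], use assms in auto)
      (rule finite_subset[of _ "T \<times> S"], use assms in auto)
  have "S \<times> T = ?A \<union> prod.swap ` ?B"
    using assms(3) by (auto simp: image_iff)
  moreover have "card (?A \<union> prod.swap ` ?B) = card ?A + card (prod.swap ` ?B)"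
    using fin by (intro card_Un_disjoint) auto
  moreover have "card (prod.swap ` ?B) = card ?B"
    by (rule card_image) (simp add: inj_on_def)
  ultimately have "card (S \<times> T) = card ?A + card ?B"
    by simp
  then have "card S * card T = card ?A + card ?B"
    by (simp add: card_cartesian_product)
  then show ?thesis
    unfolding shuffle_sign_def by (simp add: power_add)
qed

lemma shuffle_sign_empty [simp]: "shuffle_sign {} T = 1" "shuffle_sign S {} = 1"
  by (simp_all add: shuffle_sign_def)

lemma shuffle_sign_Max: "(\<And>s. s \<in> S \<Longrightarrow> s \<le> m) \<Longrightarrow> shuffle_sign S {m} = 1"
proof -
  assume "\<And>s. s \<in> S \<Longrightarrow> s \<le> m"
  then have "{(s, t). s \<in> S \<and> t \<in> {m} \<and> t < s} = {}" by (auto dest: leD)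
  then show ?thesis by (simp only: shuffle_sign_def card.empty power_0)
qed

text \<open>\<open>Pow U\<close> is then infinite and the sum over it is 0 by convention. This
  default lets the product identities hold for every \<open>anti_poly\<close>, with no restriction
  to a carrier.\<close>

lemma wedge_infinite: "infinite U \<Longrightarrow> (f \<cdot> g) U = 0"
  by (simp add: wedge_def)

text \<open>Both sides sum over the ways to cut \<open>U\<close> into three ordered blocks.
  Inversions of a disjoint union add up, so either bracketing yields the product of the three
  pairwise signs.\<close>

lemma wedge_assoc: "(f \<cdot> g) \<cdot> h = f \<cdot> (g \<cdot> h)"
proof
  fix U
  show "((f \<cdot> g) \<cdot> h) U = (f \<cdot> (g \<cdot> h)) U"
  proof (cases "finite U")
    case True
    have "((f \<cdot> g) \<cdot> h) U = (\<Sum>S\<in>Pow U. \<Sum>T\<in>Pow S.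
        shuffle_sign S (U - S) * (shuffle_sign T (S - T) * f T * g (S - T)) * h (U - S))"
      by (simp add: wedge_def sum_distrib_left sum_distrib_right)
    also have "\<dots> = (\<Sum>(S, T)\<in>Sigma (Pow U) Pow.
        shuffle_sign S (U - S) * (shuffle_sign T (S - T) * f T * g (S - T)) * h (U - S))"
      using True by (subst sum.Sigma) (auto intro: finite_subset)
    also have "\<dots> = (\<Sum>(T, W)\<in>Sigma (Pow U) (\<lambda>T. Pow (U - T)).
        shuffle_sign T (U - T) * f T *
          (shuffle_sign W ((U - T) - W) * g W * h ((U - T) - W)))"
    \<comment> \<open>A nested pair T \<subseteq> S corresponds to its first two blocks T and S - T;
      the third block is U - S on both sides.\<close>
    proof (rule sum.reindex_bij_witness[where
          i = "\<lambda>(T, W). (T \<union> W, T)" and j = "\<lambda>(S, T). (T, S - T)"]; clarify)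
      fix S T assume "S \<subseteq> U" "T \<subseteq> S"
      then have fin: "finite T" "finite (S - T)" "finite (U - S)"
        using True by (auto intro: finite_subset)
      have *: "U - T - (S - T) = U - S" "U - T = (S - T) \<union> (U - S)" "S = T \<union> (S - T)"
        using \<open>S \<subseteq> U\<close> \<open>T \<subseteq> S\<close> by auto
      have "shuffle_sign S (U - S) = shuffle_sign T (U - S) * shuffle_sign (S - T) (U - S)"
        using fin by (subst *(3), subst shuffle_sign_Un_left) auto
      moreover have "shuffle_sign T (U - T) = shuffle_sign T (S - T) * shuffle_sign T (U - S)"
        using fin by (subst *(2), subst shuffle_sign_Un_right) auto
      ultimately show "shuffle_sign T (U - T) * f T * (shuffle_sign (S - T) (U - T - (S - T))
            * g (S - T) * h (U - T - (S - T)))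
          = shuffle_sign S (U - S) * (shuffle_sign T (S - T) * f T * g (S - T)) * h (U - S)"
        unfolding *(1) by simp
    qed auto
    also have "\<dots> = (f \<cdot> (g \<cdot> h)) U"
      using True by (subst sum.Sigma[symmetric]) (auto simp: wedge_def sum_distrib_left)
    finally show ?thesis .
  qed (simp add: wedge_infinite)
qed

lemma wedge_add_left: "(f + g) \<cdot> h = f \<cdot> h + g \<cdot> h"
  and wedge_add_right: "f \<cdot> (g + h) = f \<cdot> g + f \<cdot> h"
  by (auto simp: wedge_def pointwise algebra_simps sum.distrib)

lemma wedge_diff_left: "(f - g) \<cdot> h = f \<cdot> h - g \<cdot> h"
  by (auto simp: wedge_def pointwise algebra_simps sum_subtractf)

lemma wedge_zero [simp]: "0 \<cdot> f = 0" "f \<cdot> 0 = 0"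
  by (auto simp: wedge_def pointwise)

lemma wedge_scale [simp]: "(q *\<^sub>s f) \<cdot> g = q *\<^sub>s (f \<cdot> g)" "f \<cdot> (q *\<^sub>s g) = q *\<^sub>s (f \<cdot> g)"
  by (auto simp: wedge_def scale_def pointwise sum_distrib_left algebra_simps intro!: sum.cong)

lemma wedge_sum_left: "(\<Sum>i\<in>I. f i) \<cdot> g = (\<Sum>i\<in>I. f i \<cdot> g)"
  by (induction I rule: infinite_finite_induct) (auto simp: wedge_add_left)

lemma wedge_sum_right: "g \<cdot> (\<Sum>i\<in>I. f i) = (\<Sum>i\<in>I. g \<cdot> f i)"
  by (induction I rule: infinite_finite_induct) (auto simp: wedge_add_right)

lemma scale_simps:
  "q *\<^sub>s (f + g) = q *\<^sub>s f + q *\<^sub>s g" "(q + r) *\<^sub>s f = q *\<^sub>s f + r *\<^sub>s f"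
  "q *\<^sub>s (f - g) = q *\<^sub>s f - q *\<^sub>s g" "q *\<^sub>s r *\<^sub>s f = (q * r) *\<^sub>s f"
  "1 *\<^sub>s f = f" "0 *\<^sub>s f = 0" "q *\<^sub>s 0 = 0"
  by (auto simp: scale_def pointwise algebra_simps)

lemma scale_sum: "q *\<^sub>s (\<Sum>i\<in>I. f i) = (\<Sum>i\<in>I. q *\<^sub>s f i)"
  by (induction I rule: infinite_finite_induct) (auto simp: scale_simps)

text \<open>The carrier hypothesis acts at infinite \<open>U\<close>, where every product vanishes
  but an arbitrary \<open>f\<close> might not.\<close>

lemma wedge_unit_left [simp]: "f \<in> poly_space n \<Longrightarrow> \<one>\<^sub>\<theta> \<cdot> f = f"
proof
  fix U assume f: "f \<in> poly_space n"
  show "(\<one>\<^sub>\<theta> \<cdot> f) U = f U"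
  proof (cases "finite U")
    case True
    then have "(\<one>\<^sub>\<theta> \<cdot> f) U = (\<Sum>S\<in>{{}}. shuffle_sign S (U - S) * \<one>\<^sub>\<theta> S * f (U - S))"
      unfolding wedge_def by (intro sum.mono_neutral_right) (auto simp: one_poly_def)
    then show ?thesis by (simp add: one_poly_def)
  next
    case False
    then have "\<not> U \<subseteq> {1..n}" by (meson finite_atLeastAtMost finite_subset)
    with f False show ?thesis by (simp add: wedge_infinite poly_space_iff)
  qed
qed

text \<open>Indexing by the right factor is convenient when that factor is the one with few nonzero
  coefficients, such as a linear form.\<close>

lemma wedge_flip:
  "(f \<cdot> g) U = (\<Sum>S\<in>Pow U. shuffle_sign (U - S) S * f (U - S) * g S)"
  unfolding wedge_def
  by (rule sum.reindex_bij_witness[where i = "\<lambda>S. U - S" and j = "\<lambda>S. U - S"])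
    (auto simp: double_diff)

lemma wedge_unit_right [simp]: "f \<in> poly_space n \<Longrightarrow> f \<cdot> \<one>\<^sub>\<theta> = f"
proof
  fix U assume f: "f \<in> poly_space n"
  show "(f \<cdot> \<one>\<^sub>\<theta>) U = f U"
  proof (cases "finite U")
    case True
    then have "(f \<cdot> \<one>\<^sub>\<theta>) U = (\<Sum>S\<in>{{}}. shuffle_sign (U - S) S * f (U - S) * \<one>\<^sub>\<theta> S)"
      unfolding wedge_flip by (intro sum.mono_neutral_right) (auto simp: one_poly_def)
    then show ?thesis by (simp add: one_poly_def)
  next
    case False
    then have "\<not> U \<subseteq> {1..n}" by (meson finite_atLeastAtMost finite_subset)
    with f False show ?thesis by (simp add: wedge_infinite poly_space_iff)
  qed
qed

text \<open>Moving \<open>j\<close> variables past \<open>i\<close> others takes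
  \<open>i * j\<close> transpositions. This is the sign that the Koszul product will have to
  match.\<close>

lemma hom_comp_wedge_commute:
  "hom_comp j g \<cdot> hom_comp i f = ((-1) ^ (i * j)) *\<^sub>s (hom_comp i f \<cdot> hom_comp j g)"
proof
  fix U
  show "(hom_comp j g \<cdot> hom_comp i f) U = (((-1) ^ (i * j)) *\<^sub>s (hom_comp i f \<cdot> hom_comp j g)) U"
  proof (cases "finite U")
    case True
    have "shuffle_sign (U - S) S * hom_comp j g (U - S) * hom_comp i f S
        = (-1) ^ (i * j) * (shuffle_sign S (U - S) * hom_comp i f S * hom_comp j g (U - S))"
      if "S \<subseteq> U" for S
      using that True shuffle_sign_commute[of S "U - S"]
      by (auto simp: hom_comp_def finite_subset)
    then show ?thesis
      unfolding wedge_flip[of "hom_comp j g"] unfolding wedge_def scale_def sum_distrib_left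
      by (intro sum.cong) auto
  qed (simp add: wedge_infinite scale_def)
qed

text \<open>The grading involution. It collects in one linear map the signs that the homogeneous
  components of \<open>f\<close> pick up when a linear form is moved past them.\<close>

definition parity :: "anti_poly \<Rightarrow> anti_poly" where
  "parity f = (\<lambda>S. (-1) ^ card S * f S)"

lemma parity_simps [simp]:
  "parity (f + g) = parity f + parity g" "parity (parity f) = f"
  by (auto simp: parity_def pointwise algebra_simps)

text \<open>The hypothesis says that \<open>l\<close> is supported on singletons. With
  \<open>card S = 1\<close>, \<open>shuffle_sign_commute\<close> leaves the sign (-1)^|U - S|, which
  is the one in \<open>parity\<close>.\<close>

lemma linear_wedge_commute:
  assumes "hom_comp 1 l = l"
  shows "l \<cdot> f = parity f \<cdot> l"
proof
  fix U
  have l: "l S = 0" if "card S \<noteq> 1" for S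
    using fun_cong[OF assms, of S] that by (simp add: hom_comp_def)
  show "(l \<cdot> f) U = (parity f \<cdot> l) U"
  proof (cases "finite U")
    case True
    have "shuffle_sign S (U - S) * l S * f (U - S)
      = shuffle_sign (U - S) S * parity f (U - S) * l S" if "S \<subseteq> U" for S
    proof (cases "card S = 1")
      case c: True
      have "finite S" "finite (U - S)" using that True finite_subset by auto
      then show ?thesis
        using shuffle_sign_commute[of S "U - S"] c by (auto simp: parity_def)
    qed (simp add: l)
    then show ?thesis
      unfolding wedge_flip[of "parity f"] unfolding wedge_def
      by (intro sum.cong) auto
  qed (simp add: wedge_infinite)
qed

lemma parity_linear:
  assumes "hom_comp 1 l = l"
  shows "parity l = - l"
proof
  fix S
  show "parity l S = (- l) S"
    using fun_cong[OF assms, of S]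
    by (cases "card S = 1") (auto simp: hom_comp_def parity_def pointwise)
qed

text \<open>Moving \<open>l\<close> past itself gives \<open>l \<cdot> l = - (l \<cdot> l)\<close>,
  and 2 is invertible.\<close>

lemma linear_wedge_self:
  assumes "hom_comp 1 l = l"
  shows "l \<cdot> l = 0"
proof -
  have "- l = (-1) *\<^sub>s l"
    by (simp add: scale_def pointwise)
  then have "l \<cdot> l = (-1) *\<^sub>s (l \<cdot> l)"
    using linear_wedge_commute[OF assms, of l] parity_linear[OF assms] by simp
  then show ?thesis by (simp add: scale_def pointwise)
qed

section \<open>Closure properties and the ring axioms\<close>

lemma poly_space_closed [intro, simp]:
  "f \<in> poly_space n \<Longrightarrow> g \<in> poly_space n \<Longrightarrow> f \<cdot> g \<in> poly_space n"
  "f \<in> poly_space n \<Longrightarrow> g \<in> poly_space n \<Longrightarrow> f + g \<in> poly_space n"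
  "f \<in> poly_space n \<Longrightarrow> g \<in> poly_space n \<Longrightarrow> f - g \<in> poly_space n"
  "f \<in> poly_space n \<Longrightarrow> - f \<in> poly_space n"
  "f \<in> poly_space n \<Longrightarrow> q *\<^sub>s f \<in> poly_space n"
  "f \<in> poly_space n \<Longrightarrow> hom_comp d f \<in> poly_space n"
  "f \<in> poly_space n \<Longrightarrow> parity f \<in> poly_space n"
  "\<one>\<^sub>\<theta> \<in> poly_space n" "0 \<in> poly_space n"
proof -
  assume f: "f \<in> poly_space n" and g: "g \<in> poly_space n"
  have "shuffle_sign S (U - S) * f S * g (U - S) = 0" if "\<not> U \<subseteq> {1..n}" "S \<subseteq> U" for U S
  proof -
    from that have "\<not> S \<subseteq> {1..n} \<or> \<not> U - S \<subseteq> {1..n}" by blast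
    then show ?thesis using f g unfolding poly_space_iff by (elim disjE) simp_all
  qed
  then show "f \<cdot> g \<in> poly_space n"
    unfolding poly_space_iff wedge_def by (auto intro!: sum.neutral simp del: mult_eq_0_iff)
qed (auto simp: poly_space_iff scale_def hom_comp_def parity_def one_poly_def pointwise)

lemma ring_anti_ring: "ring (anti_ring n)"
proof (rule ringI)
  show "abelian_group (anti_ring n)"
    by (rule abelian_groupI) (auto simp: algebra_simps intro!: bexI[of _ "- _"])
  show "monoid (anti_ring n)"
    by (rule monoidI) (auto simp: wedge_assoc)
qed (auto simp: wedge_add_left wedge_add_right)

lemma poly_space_sum: "(\<And>i. i \<in> I \<Longrightarrow> f i \<in> poly_space n) \<Longrightarrow> (\<Sum>i\<in>I. f i) \<in> poly_space n"
  by (induction I rule: infinite_finite_induct) auto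

section \<open>The splitting off of \<open>F\<^sub>1\<close>\<close>

definition theta_sum :: "nat \<Rightarrow> anti_poly" where
  "theta_sum n = (\<lambda>S. if \<exists>i\<in>{1..n}. S = {i} then 1 else 0)"

lemma hom_comp_theta_sum [simp]: "hom_comp (Suc 0) (theta_sum n) = theta_sum n"
  by (auto simp: hom_comp_def theta_sum_def pointwise)

lemma theta_sum_in [simp]: "theta_sum n \<in> poly_space n"
  by (auto simp: poly_space_iff theta_sum_def)

lemma theta_sum_commute: "theta_sum n \<cdot> f = parity f \<cdot> theta_sum n"
  by (simp add: linear_wedge_commute)

lemma theta_sum_self [simp]: "theta_sum n \<cdot> theta_sum n = 0"
  by (simp add: linear_wedge_self)

lemma poly_space_Suc: "f \<in> poly_space m \<Longrightarrow> f \<in> poly_space (Suc m)"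
proof -
  have "{1..m} \<subseteq> {1..Suc m}" by auto
  then show "f \<in> poly_space m \<Longrightarrow> f \<in> poly_space (Suc m)"
    unfolding poly_space_iff by blast
qed

text \<open>
  \<open>tail_part m x\<close> is the coefficient of \<open>\<theta>\<^sub>m\<^sub>+\<^sub>1\<close> in \<open>x\<close>, written to the right of the other
  variables; since \<open>\<theta>\<^sub>m\<^sub>+\<^sub>1\<close> is the largest variable, no sign occurs.
\<close>

definition tail_part :: "nat \<Rightarrow> anti_poly \<Rightarrow> anti_poly" where
  "tail_part m x = (\<lambda>S. if S \<subseteq> {1..m} then x (insert (Suc m) S) else 0)"

text \<open>On \<open>poly_space (Suc m)\<close> this substitutes minus the sum of the other
  variables for the last one, that is, it projects onto \<open>poly_space m\<close> along the
  multiples of \<open>F_1\<close>. Defined as a difference, it makes the splitting hold by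
  construction.\<close>

definition head_part :: "nat \<Rightarrow> anti_poly \<Rightarrow> anti_poly" where
  "head_part m x = x - tail_part m x \<cdot> theta_sum (Suc m)"

lemma head_tail: "x = head_part m x + tail_part m x \<cdot> theta_sum (Suc m)"
  by (simp add: head_part_def)

lemma tail_part_in [simp]: "tail_part m x \<in> poly_space m"
  by (simp add: tail_part_def poly_space_iff)

text \<open>Only the variable with index \<open>Suc m\<close> of \<open>F_1\<close> contributes: any
  other one would leave \<open>Suc m\<close> to \<open>h\<close>, which does not involve it. So
  \<open>h\<close> can be recovered from its product with \<open>F_1\<close>, which makes the
  splitting unique.\<close>

lemma wedge_theta_sum_insert:
  assumes "h \<in> poly_space m" "S \<subseteq> {1..m}"
  shows "(h \<cdot> theta_sum (Suc m)) (insert (Suc m) S) = h S"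
proof -
  let ?U = "insert (Suc m) S"
  have fin: "finite ?U" using assms(2) finite_subset by auto
  have notin: "Suc m \<notin> S" using assms(2) by auto
  have "(h \<cdot> theta_sum (Suc m)) ?U
      = (\<Sum>T\<in>{{Suc m}}. shuffle_sign (?U - T) T * h (?U - T) * theta_sum (Suc m) T)"
    unfolding wedge_flip
  proof (rule sum.mono_neutral_right)
    show "\<forall>T\<in>Pow ?U - {{Suc m}}.
        shuffle_sign (?U - T) T * h (?U - T) * theta_sum (Suc m) T = 0"
    proof
      fix T assume T: "T \<in> Pow ?U - {{Suc m}}"
      show "shuffle_sign (?U - T) T * h (?U - T) * theta_sum (Suc m) T = 0"
      proof (cases "Suc m \<in> T")
        case True
        then have "theta_sum (Suc m) T = 0" using T by (auto simp: theta_sum_def)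
        then show ?thesis by simp
      next
        case False
        then have "\<not> ?U - T \<subseteq> {1..m}" by auto
        then have "h (?U - T) = 0" by (rule poly_spaceD[OF assms(1)])
        then show ?thesis by simp
      qed
    qed
  qed (use fin in auto)
  also have "\<dots> = shuffle_sign S {Suc m} * h S"
    using notin by (simp add: theta_sum_def)
  also have "shuffle_sign S {Suc m} = 1"
    using assms(2) by (intro shuffle_sign_Max) auto
  finally show ?thesis by simp
qed

lemma tail_part_simps [simp]:
  "tail_part m (x + y) = tail_part m x + tail_part m y"
  "tail_part m (q *\<^sub>s x) = q *\<^sub>s tail_part m x"
  by (auto simp: tail_part_def scale_def pointwise)

lemma head_part_simps [simp]:
  "head_part m (x + y) = head_part m x + head_part m y"
  "head_part m (q *\<^sub>s x) = q *\<^sub>s head_part m x"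
  by (auto simp: head_part_def wedge_add_left scale_simps algebra_simps)

lemma tail_part_poly_space [simp]: "g \<in> poly_space m \<Longrightarrow> tail_part m g = 0"
  by (auto simp: tail_part_def poly_space_iff pointwise)

lemma tail_part_wedge_theta_sum [simp]:
  "h \<in> poly_space m \<Longrightarrow> tail_part m (h \<cdot> theta_sum (Suc m)) = h"
  unfolding tail_part_def by (rule ext) (metis poly_space_iff wedge_theta_sum_insert)

lemma head_part_poly_space [simp]: "g \<in> poly_space m \<Longrightarrow> head_part m g = g"
  by (simp add: head_part_def)

lemma head_part_wedge_theta_sum [simp]:
  "h \<in> poly_space m \<Longrightarrow> head_part m (h \<cdot> theta_sum (Suc m)) = 0"
  by (simp add: head_part_def)

text \<open>What has to be excluded is a coefficient at a set containing \<open>Suc m\<close>.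
  Applying \<open>tail_part\<close> to the splitting of \<open>x\<close> reproduces
  \<open>tail_part m x\<close> from the second summand alone, so the head has tail 0.\<close>

lemma head_part_in [simp]:
  assumes "x \<in> poly_space (Suc m)"
  shows "head_part m x \<in> poly_space m"
proof -
  let ?h = "head_part m x"
  have h: "?h \<in> poly_space (Suc m)"
    using assms by (auto simp: head_part_def poly_space_Suc)
  have "tail_part m x = tail_part m ?h + tail_part m x"
    using arg_cong[OF head_tail[of x m], of "tail_part m"] by simp
  then have tail: "tail_part m ?h = 0" by simp
  show ?thesis
    unfolding poly_space_iff
  proof (intro allI impI)
    fix S assume S: "\<not> S \<subseteq> {1..m}"
    show "?h S = 0"
    proof (cases "S \<subseteq> {1..Suc m}")
      case True
      then have "S - {Suc m} \<subseteq> {1..m}" "insert (Suc m) (S - {Suc m}) = S"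
        using S by (auto simp: le_Suc_eq)
      then show ?thesis
        using fun_cong[OF tail, of "S - {Suc m}"] by (simp add: tail_part_def pointwise)
    next
      case False
      then show ?thesis by (rule poly_spaceD[OF h])
    qed
  qed
qed

lemma head_part_wedge:
  assumes "x \<in> poly_space (Suc m)" "y \<in> poly_space (Suc m)"
  shows "head_part m (x \<cdot> y) = head_part m x \<cdot> head_part m y"
proof -
  let ?F = "theta_sum (Suc m)"
  define g h where "g = head_part m x" and "h = tail_part m x"
  define g' h' where "g' = head_part m y" and "h' = tail_part m y"
  note defs = g_def h_def g'_def h'_def
  have in_space: "g \<in> poly_space m" "h \<in> poly_space m" "g' \<in> poly_space m" "h' \<in> poly_space m"
    using assms by (simp_all add: defs)
  have "x \<cdot> y = (g + h \<cdot> ?F) \<cdot> (g' + h' \<cdot> ?F)"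
    unfolding defs by (simp flip: head_tail)
  also have "\<dots> = g \<cdot> g' + g \<cdot> h' \<cdot> ?F + h \<cdot> (?F \<cdot> g') + h \<cdot> (?F \<cdot> h') \<cdot> ?F"
    by (simp add: wedge_add_left wedge_add_right wedge_assoc algebra_simps)
  \<comment> \<open>The last term dies since \<open>?F \<cdot> h' \<cdot> ?F\<close> is
    \<open>parity h' \<cdot> ?F \<cdot> ?F\<close>. Both coefficients now lie in
    \<open>poly_space m\<close>, so the head can be read off.\<close>
  also have "\<dots> = g \<cdot> g' + (g \<cdot> h' + h \<cdot> parity g') \<cdot> ?F"
    by (simp add: theta_sum_commute[of _ g'] theta_sum_commute[of _ h']
        wedge_assoc wedge_add_left algebra_simps)
  finally show ?thesis
    using in_space by (simp add: g_def g'_def)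
qed

lemma hom_comp_wedge_linear:
  assumes "hom_comp 1 l = l"
  shows "hom_comp (Suc d) (h \<cdot> l) = hom_comp d h \<cdot> l" "hom_comp 0 (h \<cdot> l) = 0"
proof -
  have l: "l S = 0" if "card S \<noteq> 1" for S
    using fun_cong[OF assms, of S] that by (simp add: hom_comp_def)
  have c: "card U = Suc (card (U - S))" if "S \<subseteq> U" "finite U" "l S \<noteq> 0" for S U
  proof -
    have "card S = 1" using l that(3) by blast
    moreover from this have "card (U - S) = card U - card S"
      using that finite_subset by (intro card_Diff_subset) auto
    ultimately show ?thesis using card_mono[of U S] that by simp
  qed
  show "hom_comp (Suc d) (h \<cdot> l) = hom_comp d h \<cdot> l"
  proof
    fix U show "hom_comp (Suc d) (h \<cdot> l) U = (hom_comp d h \<cdot> l) U"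
    proof (cases "finite U")
      case True
      have "(hom_comp d h \<cdot> l) U = (\<Sum>S\<in>Pow U. (if card U = Suc d
          then shuffle_sign (U - S) S * h (U - S) * l S else 0))"
        unfolding wedge_flip
        by (rule sum.cong) (use c True in \<open>fastforce simp: hom_comp_def\<close>)+
      then show ?thesis by (simp add: hom_comp_def wedge_flip)
    qed (simp add: wedge_infinite hom_comp_def)
  qed
  show "hom_comp 0 (h \<cdot> l) = 0"
  proof
    fix U show "hom_comp 0 (h \<cdot> l) U = 0 U"
      using l[of "{}"]
      by (cases "finite U") (auto simp: hom_comp_def wedge_infinite wedge_def pointwise)
  qed
qed

lemma hom_comp_add: "hom_comp d (f + g) = hom_comp d f + hom_comp d g"
  by (auto simp: hom_comp_def pointwise)

text \<open>Components of a multiple of \<open>F_1\<close> are again multiples of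
  \<open>F_1\<close>, hence have head 0. This makes the grading descend to the quotient, where the
  Koszul sign depends on it.\<close>

lemma head_part_hom_comp:
  assumes "x \<in> poly_space (Suc m)"
  shows "head_part m (hom_comp d x) = hom_comp d (head_part m x)"
proof -
  have "hom_comp d x = hom_comp d (head_part m x) + hom_comp d (tail_part m x \<cdot> theta_sum (Suc m))"
    by (subst head_tail[of x m]) (rule hom_comp_add)
  moreover have "head_part m (hom_comp d (tail_part m x \<cdot> theta_sum (Suc m))) = 0"
    by (cases d) (simp_all add: hom_comp_wedge_linear)
  ultimately show ?thesis using assms by simp
qed

section \<open>The symmetric invariants\<close>

text \<open>The product substituted for a monomial in \<open>perm_act\<close>, freed from the formal
  dependence on \<open>n\<close>.\<close>

definition theta_prod :: "nat list \<Rightarrow> anti_poly" where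
  "theta_prod l = foldr (\<cdot>) (map theta l) \<one>\<^sub>\<theta>"

lemma theta_prod_simps [simp]:
  "theta_prod [] = \<one>\<^sub>\<theta>" "theta_prod (i # l) = theta i \<cdot> theta_prod l"
  by (simp_all add: theta_prod_def)

text \<open>A product of variables is a multiple of a single monomial. Its coefficient is left open:
  the sorting sign of a long list is never computed, only compared with that of another
  list.\<close>

lemma theta_prod_support: "theta_prod l U \<noteq> 0 \<Longrightarrow> U = set l"
proof (induction l arbitrary: U)
  case Nil
  then show ?case by (auto simp: one_poly_def split: if_splits)
next
  case (Cons i l)
  then have "(\<Sum>S\<in>Pow U. shuffle_sign S (U - S) * theta i S * theta_prod l (U - S)) \<noteq> 0"
    by (simp add: wedge_def)
  then obtain S where "S \<subseteq> U" "theta i S \<noteq> 0" "theta_prod l (U - S) \<noteq> 0"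
    by (metis (no_types, lifting) PowD mult_eq_0_iff sum.neutral)
  then show ?case
    using Cons.IH[of "U - S"] by (auto simp: theta_def split: if_splits)
qed

section \<open>The permutation action on coefficients\<close>

lemma perm_act_eq:
  "perm_act n \<sigma> f U = (\<Sum>S\<in>Pow {1..n}. f S * theta_prod (map \<sigma> (sorted_list_of_set S)) U)"
  by (simp add: perm_act_def theta_prod_def hom_comp_def o_def)

lemma perm_act_image:
  assumes "\<sigma> permutes {1..n}" "S \<subseteq> {1..n}"
  shows "perm_act n \<sigma> f (\<sigma> ` S) = f S * theta_prod (map \<sigma> (sorted_list_of_set S)) (\<sigma> ` S)"
proof -
  have "perm_act n \<sigma> f (\<sigma> ` S)
      = (\<Sum>T\<in>{S}. f T * theta_prod (map \<sigma> (sorted_list_of_set T)) (\<sigma> ` S))"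
    unfolding perm_act_eq
  proof (rule sum.mono_neutral_right)
    show "\<forall>T\<in>Pow {1..n} - {S}. f T * theta_prod (map \<sigma> (sorted_list_of_set T)) (\<sigma> ` S) = 0"
    proof (rule ballI, rule ccontr)
      fix T assume T: "T \<in> Pow {1..n} - {S}"
        "f T * theta_prod (map \<sigma> (sorted_list_of_set T)) (\<sigma> ` S) \<noteq> 0"
      then have "\<sigma> ` S = set (map \<sigma> (sorted_list_of_set T))"
        by (intro theta_prod_support) auto
      also have "\<dots> = \<sigma> ` T"
        using T(1) finite_subset[of T "{1..n}"] by simp
      finally show False
        using T permutes_inj[OF assms(1)] by (auto simp: inj_image_eq_iff)
    qed
  qed (use assms in auto)
  then show ?thesis by simp
qed

lemma perm_act_outside:
  assumes "\<sigma> permutes {1..n}" "\<not> U \<subseteq> {1..n}"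
  shows "perm_act n \<sigma> f U = 0"
  unfolding perm_act_eq
proof (rule sum.neutral, rule ballI, rule ccontr)
  fix T assume T: "T \<in> Pow {1..n}" "f T * theta_prod (map \<sigma> (sorted_list_of_set T)) U \<noteq> 0"
  then have "U = set (map \<sigma> (sorted_list_of_set T))"
    by (intro theta_prod_support) auto
  also have "\<dots> = \<sigma> ` T"
    using T(1) finite_subset[of T "{1..n}"] by simp
  also have "\<dots> \<subseteq> {1..n}"
    using T permutes_image[OF assms(1)] by blast
  finally show False using assms(2) by simp
qed

lemma theta_in [simp]: "theta i \<in> poly_space n" if "i \<in> {1..n}"
  using that by (auto simp: theta_def poly_space_iff)

lemma theta_anticommute: "theta j \<cdot> theta i = - (theta i \<cdot> theta j)"
proof -
  have lin: "hom_comp 1 (theta k) = theta k" for k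
    by (auto simp: hom_comp_def theta_def pointwise)
  have "- theta i = (-1) *\<^sub>s theta i" "- (theta i \<cdot> theta j) = (-1) *\<^sub>s (theta i \<cdot> theta j)"
    by (simp_all add: scale_def pointwise)
  then show ?thesis
    by (simp add: linear_wedge_commute[OF lin] parity_linear[OF lin])
qed

section \<open>Determination of the invariants\<close>

lemma sym_ring_carrier:
  "carrier (sym_ring n) = {f \<in> poly_space n. \<forall>\<sigma>. \<sigma> permutes {1..n} \<longrightarrow> perm_act n \<sigma> f = f}"
  by (simp add: sym_ring_def)

text \<open>Transposing the two smallest elements of \<open>S\<close> fixes \<open>S\<close> but
  swaps the first two factors of its monomial, so the coefficient equals its own negative.\<close>

lemma sym_coeff_degree_ge_2:
  assumes f: "f \<in> carrier (sym_ring n)" and S: "S \<subseteq> {1..n}" "card S \<ge> 2"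
  shows "f S = 0"
proof -
  have fin: "finite S" using S finite_subset by auto
  then obtain i j r where ij: "sorted_list_of_set S = i # j # r"
    using S(2) by (metis One_nat_def length_0_conv length_Suc_conv list.exhaust
        length_sorted_list_of_set not_less_eq_eq numeral_2_eq_2 le0)
  then have dist: "i \<noteq> j" "i \<notin> set r" "j \<notin> set r" and ijS: "i \<in> S" "j \<in> S"
    using distinct_sorted_list_of_set[of S] set_sorted_list_of_set[OF fin] by auto
  define \<tau> where "\<tau> = Transposition.transpose i j"
  have \<tau>: "\<tau> permutes {1..n}"
    unfolding \<tau>_def using ijS S by (intro permutes_swap_id) auto
  have \<tau>S: "\<tau> ` S = S"
    using ijS unfolding \<tau>_def by simp
  have "map \<tau> (sorted_list_of_set S) = j # i # r"
    unfolding ij \<tau>_def using dist by (auto simp: transpose_def intro: map_idI)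
  then have "theta_prod (map \<tau> (sorted_list_of_set S)) = theta j \<cdot> theta i \<cdot> theta_prod r"
    by (simp add: wedge_assoc)
  also have "\<dots> = - (theta i \<cdot> theta j) \<cdot> theta_prod r"
    by (subst theta_anticommute) simp
  also have "\<dots> = - theta_prod (sorted_list_of_set S)"
    unfolding ij using wedge_diff_left[of 0 "theta i \<cdot> theta j" "theta_prod r"]
    by (simp add: wedge_assoc)
  finally have "f S = - (f S * theta_prod (sorted_list_of_set S) S)"
    using f \<tau> perm_act_image[OF \<tau> S(1), of f] \<tau>S by (simp add: sym_ring_carrier pointwise)
  \<comment> \<open>Invariance under the identity replaces a computation of the coefficient of the
    sorted product.\<close>
  moreover have "f S = f S * theta_prod (sorted_list_of_set S) S"
    using f perm_act_image[OF permutes_id S(1), of f] permutes_id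
    by (simp add: sym_ring_carrier)
  ultimately show ?thesis by simp
qed

lemma sym_coeff_degree_1:
  assumes f: "f \<in> carrier (sym_ring n)" and "i \<in> {1..n}" "j \<in> {1..n}"
  shows "f {i} = f {j}"
proof -
  define \<tau> where "\<tau> = Transposition.transpose i j"
  have \<tau>: "\<tau> permutes {1..n}"
    unfolding \<tau>_def using assms by (intro permutes_swap_id) auto
  have "\<tau> i = j" by (simp add: \<tau>_def)
  have "theta j \<cdot> \<one>\<^sub>\<theta> = theta j"
    using assms(3) theta_in wedge_unit_right by blast
  then show ?thesis
    using f \<tau> perm_act_image[OF \<tau>, of "{i}" f] assms \<open>\<tau> i = j\<close>
    by (simp add: sym_ring_carrier theta_def)
qed

lemma unit_theta_sum_apply:
  "(a *\<^sub>s \<one>\<^sub>\<theta> + b *\<^sub>s theta_sum n) S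
    = (if S = {} then a else if \<exists>i\<in>{1..n}. S = {i} then b else 0)"
  by (auto simp: scale_def one_poly_def theta_sum_def pointwise)

text \<open>In degrees 0 and 1 the product in \<open>perm_act_image\<close> has coefficient 1 and
  the coefficients at a set and at its image agree; in higher degree both vanish.\<close>

lemma unit_theta_sum_symmetric:
  "a *\<^sub>s \<one>\<^sub>\<theta> + b *\<^sub>s theta_sum n \<in> carrier (sym_ring n)" (is "?f \<in> _")
  unfolding sym_ring_carrier
proof (intro CollectI conjI allI impI ext)
  show f: "?f \<in> poly_space n" by simp
  fix \<sigma> U assume \<sigma>: "\<sigma> permutes {1..n}"
  show "perm_act n \<sigma> ?f U = ?f U"
  proof (cases "U \<subseteq> {1..n}")
    case True
    then obtain S where S: "S \<subseteq> {1..n}" and U: "U = \<sigma> ` S"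
      using permutes_image[OF \<sigma>] by (metis subset_image_iff)
    have inj: "inj_on \<sigma> S" using permutes_inj[OF \<sigma>] inj_on_subset by blast
    consider "S = {}" | i where "S = {i}" "i \<in> {1..n}" | "card S > 1"
      using S finite_subset[OF S]
      by (metis One_nat_def card_1_singletonE card_gt_0_iff finite_atLeastAtMost insert_subset
          less_one linorder_neqE_nat not_less_iff_gr_or_eq)
    then show ?thesis
    proof cases
      case 1
      then show ?thesis using perm_act_image[OF \<sigma> S, of ?f] U by (simp add: one_poly_def)
    next
      case 2
      have "\<sigma> i \<in> {1..n}" using permutes_in_image[OF \<sigma>] 2(2) by blast
      moreover from this have "theta (\<sigma> i) \<cdot> \<one>\<^sub>\<theta> = theta (\<sigma> i)"
        using theta_in wedge_unit_right by blast
      ultimately show ?thesis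
        using perm_act_image[OF \<sigma> S, of ?f] U 2
        by (simp add: unit_theta_sum_apply) (simp add: theta_def)
    next
      case 3
      moreover have "card U > 1" using 3 U inj by (simp add: card_image)
      ultimately have "?f S = 0" "?f U = 0" by (auto simp: unit_theta_sum_apply)
      then show ?thesis using perm_act_image[OF \<sigma> S, of ?f] U by simp
    qed
  next
    case False
    then have "?f U = 0" by (rule poly_spaceD[OF f])
    with False \<sigma> show ?thesis by (simp add: perm_act_outside)
  qed
qed

text \<open>All coefficients of degree 1 agree, so the one at \<open>{1}\<close> stands for them.
  For \<open>n = 0\<close> there are none, and \<open>theta_sum n\<close> is 0.\<close>

lemma sym_ring_expand:
  assumes f: "f \<in> carrier (sym_ring n)"
  shows "f = f {} *\<^sub>s \<one>\<^sub>\<theta> + f {1} *\<^sub>s theta_sum n"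
proof
  fix S
  consider "S = {}" | i where "S = {i}" "i \<in> {1..n}" | "S \<subseteq> {1..n}" "card S \<ge> 2"
    | "\<not> S \<subseteq> {1..n}"
    by (metis Suc_1 Suc_leI card_1_singletonE card_gt_0_iff finite_atLeastAtMost finite_subset
        insert_subset le_neq_implies_less One_nat_def)
  then show "f S = (f {} *\<^sub>s \<one>\<^sub>\<theta> + f {1} *\<^sub>s theta_sum n) S"
  proof cases
    case 2
    then show ?thesis
      using sym_coeff_degree_1[OF f, of i 1] by (auto simp: unit_theta_sum_apply)
  next
    case 3
    then have "f S = 0" using sym_coeff_degree_ge_2[OF f] by blast
    with 3 show ?thesis by (auto simp: unit_theta_sum_apply)
  next
    case 4
    then have "f S = 0" using f by (simp add: sym_ring_carrier poly_space_iff)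
    with 4 show ?thesis by (auto simp: unit_theta_sum_apply)
  qed (simp add: unit_theta_sum_apply)
qed

lemma sym_ringE:
  assumes "f \<in> carrier (sym_ring n)"
  obtains a b where "f = a *\<^sub>s \<one>\<^sub>\<theta> + b *\<^sub>s theta_sum n"
  using sym_ring_expand[OF assms] by blast

lemma sym_ring_poly_space: "f \<in> carrier (sym_ring n) \<Longrightarrow> f \<in> poly_space n"
  by (simp add: sym_ring_carrier)

lemma sym_ring_simps [simp]:
  "mult (sym_ring n) = (\<cdot>)" "one (sym_ring n) = \<one>\<^sub>\<theta>" "zero (sym_ring n) = 0"
  "add (sym_ring n) = (+)" "smult (sym_ring n) = (*\<^sub>s)" "hcomp (sym_ring n) = hom_comp"
  by (simp_all add: sym_ring_def)

section \<open>The ideal generated by the invariants of positive degree\<close>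

lemma head_part_ideal: "ideal {x \<in> poly_space (Suc m). head_part m x = 0} (anti_ring (Suc m))"
proof -
  interpret ring "anti_ring (Suc m)" by (rule ring_anti_ring)
  have "ring_hom_ring (anti_ring (Suc m)) (anti_ring (Suc m)) (head_part m)"
    by (rule ring_hom_ringI)
      (auto simp: ring_anti_ring head_part_wedge intro: poly_space_Suc)
  then show ?thesis
    using ring_hom_ring.kernel_is_ideal by (fastforce simp: a_kernel_def')
qed

text \<open>A generator is a multiple of \<open>F_1\<close>, so it lies in the kernel of
  \<open>head_part\<close>, which is an ideal. Conversely an element with head 0 is its tail times
  \<open>F_1\<close>, and \<open>F_1\<close> is itself a generator.\<close>

lemma J_ideal_eq: "J_ideal (Suc m) = {x \<in> poly_space (Suc m). head_part m x = 0}"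
proof -
  interpret ring "anti_ring (Suc m)" by (rule ring_anti_ring)
  let ?F = "theta_sum (Suc m)"
  let ?G = "{f \<in> carrier (sym_ring (Suc m)). \<exists>d>0. hcomp (anti_ring (Suc m)) d f = f}"
  have F: "?F \<in> ?G"
    using unit_theta_sum_symmetric[of 0 1 "Suc m"]
    by (auto simp: scale_simps intro!: exI[of _ "Suc 0"])
  have sub: "?G \<subseteq> carrier (anti_ring (Suc m))"
    by (auto simp: sym_ring_carrier)
  have "?G \<subseteq> {x \<in> poly_space (Suc m). head_part m x = 0}"
  proof clarify
    fix f d assume f: "f \<in> carrier (sym_ring (Suc m))" and d: "0 < d"
      "hcomp (anti_ring (Suc m)) d f = f"
    obtain a b where ab: "f = a *\<^sub>s \<one>\<^sub>\<theta> + b *\<^sub>s ?F" using f by (rule sym_ringE)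
    \<comment> \<open>The empty set has size 0, so positive degree removes the constant
      term.\<close>
    have "f {} = 0" using d(1) fun_cong[OF d(2), of "{}"] by (simp add: hom_comp_def split: if_splits)
    then have "a = 0" by (simp add: ab unit_theta_sum_apply)
    then have "f = (b *\<^sub>s \<one>\<^sub>\<theta>) \<cdot> ?F"
      using wedge_unit_left[OF theta_sum_in] by (simp add: ab scale_simps)
    moreover have "head_part m ((b *\<^sub>s \<one>\<^sub>\<theta>) \<cdot> ?F) = 0"
      by (rule head_part_wedge_theta_sum) simp
    ultimately show "f \<in> poly_space (Suc m) \<and> head_part m f = 0"
      using f by (simp add: sym_ring_carrier)
  qed
  then have "J_ideal (Suc m) \<subseteq> {x \<in> poly_space (Suc m). head_part m x = 0}"
    unfolding J_ideal_def by (intro genideal_minimal head_part_ideal)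
  moreover have "x \<in> J_ideal (Suc m)" if "x \<in> poly_space (Suc m)" "head_part m x = 0" for x
  proof -
    have "?F \<in> J_ideal (Suc m)"
      unfolding J_ideal_def using genideal_self[OF sub] F by blast
    moreover have "ideal (J_ideal (Suc m)) (anti_ring (Suc m))"
      unfolding J_ideal_def by (rule genideal_ideal[OF sub])
    ultimately have "tail_part m x \<cdot> ?F \<in> J_ideal (Suc m)"
      using ideal.I_l_closed[of "J_ideal (Suc m)" "anti_ring (Suc m)" ?F "tail_part m x"]
      by (simp add: poly_space_Suc)
    then show ?thesis using head_tail[of x m] that(2) by simp
  qed
  ultimately show ?thesis by blast
qed

section \<open>Freeness over the symmetric invariants\<close>

text \<open>The invariants multiply like dual numbers. The formula is symmetric in the two factors,
  which gives a commutative ring although \<open>F_1\<close> is odd.\<close>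

lemma unit_theta_sum_wedge:
  "(a *\<^sub>s \<one>\<^sub>\<theta> + b *\<^sub>s theta_sum n) \<cdot> (c *\<^sub>s \<one>\<^sub>\<theta> + d *\<^sub>s theta_sum n)
    = (a * c) *\<^sub>s \<one>\<^sub>\<theta> + (a * d + b * c) *\<^sub>s theta_sum n"
proof -
  have "\<one>\<^sub>\<theta> \<cdot> theta_sum n = theta_sum n" "theta_sum n \<cdot> \<one>\<^sub>\<theta> = theta_sum n"
    "\<one>\<^sub>\<theta> \<cdot> \<one>\<^sub>\<theta> = \<one>\<^sub>\<theta>"
    using wedge_unit_left wedge_unit_right theta_sum_in poly_space_closed(8) by blast+
  then show ?thesis
    by (simp add: wedge_add_left wedge_add_right scale_simps algebra_simps)
qed

lemma unit_theta_sum_add: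
  "(a *\<^sub>s \<one>\<^sub>\<theta> + b *\<^sub>s theta_sum n) + (c *\<^sub>s \<one>\<^sub>\<theta> + d *\<^sub>s theta_sum n)
    = (a + c) *\<^sub>s \<one>\<^sub>\<theta> + (b + d) *\<^sub>s theta_sum n"
  by (simp add: scale_simps algebra_simps)

lemma sym_ring_scale:
  assumes "f \<in> carrier (sym_ring n)"
  shows "q *\<^sub>s f \<in> carrier (sym_ring n)"
proof -
  obtain a b where f: "f = a *\<^sub>s \<one>\<^sub>\<theta> + b *\<^sub>s theta_sum n" using assms by (rule sym_ringE)
  show ?thesis
    unfolding f scale_simps(1,4) by (rule unit_theta_sum_symmetric)
qed

lemma sym_ring_uminus: "f \<in> carrier (sym_ring n) \<Longrightarrow> - f \<in> carrier (sym_ring n)"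
  using sym_ring_scale[of f n "-1"] by (simp add: scale_def pointwise fun_Compl_def)

lemma sym_ring_closed:
  assumes "f \<in> carrier (sym_ring n)" "g \<in> carrier (sym_ring n)"
  shows "f + g \<in> carrier (sym_ring n)" "f \<cdot> g \<in> carrier (sym_ring n)"
    and sym_ring_commute: "f \<cdot> g = g \<cdot> f"
proof -
  obtain a b where f: "f = a *\<^sub>s \<one>\<^sub>\<theta> + b *\<^sub>s theta_sum n" using assms(1) by (rule sym_ringE)
  obtain c d where g: "g = c *\<^sub>s \<one>\<^sub>\<theta> + d *\<^sub>s theta_sum n" using assms(2) by (rule sym_ringE)
  show "f + g \<in> carrier (sym_ring n)" "f \<cdot> g \<in> carrier (sym_ring n)"
    unfolding f g unit_theta_sum_add unit_theta_sum_wedge by (rule unit_theta_sum_symmetric)+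
  show "f \<cdot> g = g \<cdot> f"
    unfolding f g unit_theta_sum_wedge by (simp add: algebra_simps)
qed

lemma sym_ring_unit [simp]: "\<one>\<^sub>\<theta> \<in> carrier (sym_ring n)"
  and sym_ring_theta_sum [simp]: "theta_sum n \<in> carrier (sym_ring n)"
  and sym_ring_zero [simp]: "0 \<in> carrier (sym_ring n)"
  using unit_theta_sum_symmetric[of 1 0 n] unit_theta_sum_symmetric[of 0 1 n]
    unit_theta_sum_symmetric[of 0 0 n] by (simp_all add: scale_simps)

lemma cring_sym_ring: "cring (sym_ring n)"
proof (rule cringI)
  show "abelian_group (sym_ring n)"
    by (rule abelian_groupI)
      (auto simp: algebra_simps sym_ring_closed sym_ring_uminus intro!: bexI[of _ "- _"])
  show "Group.comm_monoid (sym_ring n)"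
    by (rule comm_monoidI)
      (auto simp: wedge_assoc sym_ring_closed dest: sym_ring_poly_space intro: sym_ring_commute)
qed (auto simp: wedge_add_left)

section \<open>The algebra as a module over its invariants\<close>

abbreviation regular_module :: "nat \<Rightarrow> (anti_poly, anti_poly) module" where
  "regular_module n \<equiv> left_regular (anti_ring n)"

lemma regular_module_simps [simp]:
  "carrier (regular_module n) = poly_space n" "zero (regular_module n) = 0"
  "add (regular_module n) = (+)" "smult (regular_module n) = (\<cdot>)"
  by (simp_all add: left_regular_def)

lemma abelian_group_regular_module: "abelian_group (regular_module n)"
  by (rule abelian_groupI) (auto simp: algebra_simps intro!: bexI[of _ "- _"])

lemma module_regular_module: "module (sym_ring n) (regular_module n)"
  by (rule moduleI)
    (auto simp: cring_sym_ring abelian_group_regular_module wedge_assoc wedge_add_left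
      wedge_add_right dest: sym_ring_poly_space)

lemma finsum_regular_module:
  assumes "finite A" "\<And>a. a \<in> A \<Longrightarrow> f a \<in> poly_space n"
  shows "finsum (regular_module n) f A = sum f A"
proof -
  interpret abelian_group "regular_module n" by (rule abelian_group_regular_module)
  show ?thesis
    using assms by (induction A rule: finite_induct) (simp_all add: Pi_def)
qed

section \<open>The monomial basis\<close>

definition monomial :: "nat set \<Rightarrow> anti_poly" where
  "monomial S = (\<lambda>U. if U = S then 1 else 0)"

lemma inj_monomial: "inj_on monomial X"
  by (auto simp: inj_on_def monomial_def fun_eq_iff split: if_splits)

lemma monomial_in: "S \<subseteq> {1..n} \<Longrightarrow> monomial S \<in> poly_space n"
  by (simp add: poly_space_iff monomial_def)

lemma sum_fun_apply: "sum f A x = (\<Sum>a\<in>A. f a x)"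
  by (induction A rule: infinite_finite_induct) (simp_all add: pointwise)

text \<open>The index set is the one of \<open>koszul_mult\<close>. It must be shown finite, since
  otherwise the sum would be 0 by default; no degree exceeds \<open>n\<close>.\<close>

lemma sum_hom_comp:
  assumes "f \<in> poly_space n"
  shows "(\<Sum>i | hom_comp i f \<noteq> 0. hom_comp i f) = f"
proof -
  have "hom_comp i f = 0" if "i > n" for i
  proof
    fix U
    have "card U \<noteq> i" if "U \<subseteq> {1..n}"
      using card_mono[OF _ that] \<open>i > n\<close> by auto
    then show "hom_comp i f U = 0 U"
      using poly_spaceD[OF assms, of U] by (auto simp: hom_comp_def pointwise)
  qed
  then have sub: "{i. hom_comp i f \<noteq> 0} \<subseteq> {..n}" 
    by (metis (mono_tags) CollectD atMost_iff linorder_not_le subsetI)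
  have "(\<Sum>i | hom_comp i f \<noteq> 0. hom_comp i f) = (\<Sum>i\<le>n. hom_comp i f)"
    by (rule sum.mono_neutral_left) (use sub in auto)
  also have "\<dots> = f"
  proof
    fix U
    have "f U = 0" if "card U > n"
    proof (rule poly_spaceD[OF assms])
      show "\<not> U \<subseteq> {1..n}" using card_mono[of "{1..n}" U] that by auto
    qed
    then show "(\<Sum>i\<le>n. hom_comp i f) U = f U"
      by (auto simp: sum_fun_apply hom_comp_def not_le)
  qed
  finally show ?thesis .
qed

text \<open>Turns a family of coefficients, arbitrary outside the subsets of \<open>{1..m}\<close>,
  into an element of \<open>poly_space m\<close>.\<close>

definition truncate :: "nat \<Rightarrow> anti_poly \<Rightarrow> anti_poly" where
  "truncate m f = (\<lambda>S. if S \<subseteq> {1..m} then f S else 0)"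

lemma truncate_in [simp]: "truncate m f \<in> poly_space m"
  by (simp add: truncate_def poly_space_iff)

lemma truncate_poly_space: "f \<in> poly_space m \<Longrightarrow> truncate m f = f"
  by (auto simp: truncate_def fun_eq_iff poly_space_iff)

lemma sum_monomial: "(\<Sum>S\<in>Pow {1..m}. f S *\<^sub>s monomial S) = truncate m f"
  by (auto simp: fun_eq_iff sum_fun_apply scale_def monomial_def truncate_def
      if_distrib[of "(*) _"] sum.delta' cong: if_cong)

text \<open>Scalars act from the left, whereas the splitting has \<open>F_1\<close> on the right;
  moving it past \<open>monomial S\<close> costs (-1)^|S|, which is absorbed into the coefficient
  \<open>g S\<close>.\<close>

lemma sum_sym_monomial:
  "(\<Sum>S\<in>Pow {1..m}. (f S *\<^sub>s \<one>\<^sub>\<theta> + g S *\<^sub>s theta_sum (Suc m)) \<cdot> monomial S)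
    = truncate m f + truncate m (parity g) \<cdot> theta_sum (Suc m)"
proof -
  have "(f S *\<^sub>s \<one>\<^sub>\<theta> + g S *\<^sub>s theta_sum (Suc m)) \<cdot> monomial S
      = f S *\<^sub>s monomial S + (parity g S *\<^sub>s monomial S) \<cdot> theta_sum (Suc m)"
    if "S \<in> Pow {1..m}" for S
  proof -
    have "\<one>\<^sub>\<theta> \<cdot> monomial S = monomial S"
      using monomial_in that by (intro wedge_unit_left) auto
    moreover have "g S *\<^sub>s parity (monomial S) = parity g S *\<^sub>s monomial S"
      by (auto simp: scale_def parity_def monomial_def)
    ultimately show ?thesis
      by (simp add: wedge_add_left theta_sum_commute) (simp flip: wedge_scale(1))
  qed
  then have "(\<Sum>S\<in>Pow {1..m}. (f S *\<^sub>s \<one>\<^sub>\<theta> + g S *\<^sub>s theta_sum (Suc m)) \<cdot> monomial S)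
      = (\<Sum>S\<in>Pow {1..m}. f S *\<^sub>s monomial S + (parity g S *\<^sub>s monomial S) \<cdot> theta_sum (Suc m))"
    by (intro sum.cong refl)
  then show ?thesis
    by (simp only: sum.distrib sum_monomial flip: wedge_sum_left)
qed

text \<open>Puts any linear combination into split form, so that existence and uniqueness of the
  coefficients become questions about \<open>head_part\<close> and \<open>tail_part\<close>.\<close>

lemma monomial_combination:
  assumes "\<forall>b\<in>monomial ` Pow {1..m}. c b \<in> carrier (sym_ring (Suc m))"
  shows "(\<Oplus>\<^bsub>regular_module (Suc m)\<^esub>b\<in>{b \<in> monomial ` Pow {1..m}. c b \<noteq> 0}. c b \<cdot> b)
    = truncate m (\<lambda>S. c (monomial S) {})
      + truncate m (parity (\<lambda>S. c (monomial S) {1})) \<cdot> theta_sum (Suc m)"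
proof -
  let ?B = "monomial ` Pow {1..m}"
  have in_space: "c b \<cdot> b \<in> poly_space (Suc m)" if "b \<in> ?B" for b
    using that assms
    by (intro poly_space_closed(1)) (use monomial_in poly_space_Suc sym_ring_poly_space in blast)+
  have "(\<Oplus>\<^bsub>regular_module (Suc m)\<^esub>b\<in>{b \<in> ?B. c b \<noteq> 0}. c b \<cdot> b)
      = (\<Sum>b\<in>{b \<in> ?B. c b \<noteq> 0}. c b \<cdot> b)"
    using in_space by (intro finsum_regular_module) auto
  also have "\<dots> = (\<Sum>b\<in>?B. c b \<cdot> b)"
    by (intro sum.mono_neutral_left) auto
  also have "\<dots> = (\<Sum>S\<in>Pow {1..m}. c (monomial S) \<cdot> monomial S)"
    by (simp add: sum.reindex[OF inj_monomial])
  also have "\<dots> = (\<Sum>S\<in>Pow {1..m}. (c (monomial S) {} *\<^sub>s \<one>\<^sub>\<theta>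
      + c (monomial S) {1} *\<^sub>s theta_sum (Suc m)) \<cdot> monomial S)"
    using assms by (intro sum.cong refl arg_cong[where f = "\<lambda>f. f \<cdot> _"] sym_ring_expand) auto
  finally show ?thesis unfolding sum_sym_monomial .
qed

lemma is_basis_monomials:
  "is_basis (sym_ring (Suc m)) (regular_module (Suc m)) (monomial ` Pow {1..m})"
    (is "is_basis ?S ?M ?B")
proof -
  let ?F = "theta_sum (Suc m)"
  have "\<exists>!c. (\<forall>b\<in>?B. c b \<in> carrier ?S) \<and> (\<forall>b. b \<notin> ?B \<longrightarrow> c b = 0)
      \<and> finite {b \<in> ?B. c b \<noteq> 0} \<and> x = (\<Oplus>\<^bsub>?M\<^esub>b\<in>{b \<in> ?B. c b \<noteq> 0}. c b \<cdot> b)"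
    if x: "x \<in> poly_space (Suc m)" for x
  proof (rule ex_ex1I)
    \<comment> \<open>The head supplies the constant terms and the tail the multiples of
      \<open>?F\<close>; \<open>parity\<close> cancels the sign from
      \<open>sum_sym_monomial\<close>, being an involution.\<close>
    define c where "c b = (if b \<in> ?B then
        let S = inv_into (Pow {1..m}) monomial b
        in head_part m x S *\<^sub>s \<one>\<^sub>\<theta> + parity (tail_part m x) S *\<^sub>s ?F else 0)" for b
    have c: "c (monomial S) = head_part m x S *\<^sub>s \<one>\<^sub>\<theta> + parity (tail_part m x) S *\<^sub>s ?F"
      if "S \<subseteq> {1..m}" for S
      using that inv_into_f_f[OF inj_monomial, of S "Pow {1..m}"] by (simp add: c_def)
    have sym: "\<forall>b\<in>?B. c b \<in> carrier ?S"
      using c unit_theta_sum_symmetric by auto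
    have "truncate m (\<lambda>S. c (monomial S) {}) = head_part m x"
      using poly_spaceD[OF head_part_in[OF x]]
      by (simp add: fun_eq_iff truncate_def c unit_theta_sum_apply)
    moreover have "truncate m (parity (\<lambda>S. c (monomial S) {1})) = truncate m (tail_part m x)"
      by (auto simp: fun_eq_iff truncate_def c unit_theta_sum_apply parity_def)
    ultimately have "x = (\<Oplus>\<^bsub>?M\<^esub>b\<in>{b \<in> ?B. c b \<noteq> 0}. c b \<cdot> b)"
      unfolding monomial_combination[OF sym]
      using head_tail[of x m] by (simp add: truncate_poly_space)
    then show "\<exists>c. (\<forall>b\<in>?B. c b \<in> carrier ?S) \<and> (\<forall>b. b \<notin> ?B \<longrightarrow> c b = 0)
        \<and> finite {b \<in> ?B. c b \<noteq> 0} \<and> x = (\<Oplus>\<^bsub>?M\<^esub>b\<in>{b \<in> ?B. c b \<noteq> 0}. c b \<cdot> b)"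
      using sym by (intro exI[of _ c]) (auto simp: c_def)
  next
    fix c c'
    assume "(\<forall>b\<in>?B. c b \<in> carrier ?S) \<and> (\<forall>b. b \<notin> ?B \<longrightarrow> c b = 0)
        \<and> finite {b \<in> ?B. c b \<noteq> 0} \<and> x = (\<Oplus>\<^bsub>?M\<^esub>b\<in>{b \<in> ?B. c b \<noteq> 0}. c b \<cdot> b)"
      and "(\<forall>b\<in>?B. c' b \<in> carrier ?S) \<and> (\<forall>b. b \<notin> ?B \<longrightarrow> c' b = 0)
        \<and> finite {b \<in> ?B. c' b \<noteq> 0} \<and> x = (\<Oplus>\<^bsub>?M\<^esub>b\<in>{b \<in> ?B. c' b \<noteq> 0}. c' b \<cdot> b)"
    then have c: "\<forall>b\<in>?B. c b \<in> carrier ?S" "\<forall>b. b \<notin> ?B \<longrightarrow> c b = 0"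
        "x = (\<Oplus>\<^bsub>?M\<^esub>b\<in>{b \<in> ?B. c b \<noteq> 0}. c b \<cdot> b)"
      and c': "\<forall>b\<in>?B. c' b \<in> carrier ?S" "\<forall>b. b \<notin> ?B \<longrightarrow> c' b = 0"
        "x = (\<Oplus>\<^bsub>?M\<^esub>b\<in>{b \<in> ?B. c' b \<noteq> 0}. c' b \<cdot> b)"
      by blast+
    \<comment> \<open>Head and tail of \<open>x\<close> determine all coefficients at
      \<open>{}\<close> and \<open>{1}\<close>, and these two determine an invariant.\<close>
    note x_eq = c(3)[unfolded monomial_combination[OF c(1)]]
      c'(3)[unfolded monomial_combination[OF c'(1)]]
    have "truncate m (\<lambda>S. c (monomial S) {}) = truncate m (\<lambda>S. c' (monomial S) {})"
      using arg_cong[OF x_eq(1), of "head_part m"] arg_cong[OF x_eq(2), of "head_part m"]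
      by simp
    moreover have "truncate m (parity (\<lambda>S. c (monomial S) {1}))
        = truncate m (parity (\<lambda>S. c' (monomial S) {1}))"
      using arg_cong[OF x_eq(1), of "tail_part m"] arg_cong[OF x_eq(2), of "tail_part m"]
      by simp
    ultimately have eq: "c (monomial S) {} = c' (monomial S) {}"
        "c (monomial S) {1} = c' (monomial S) {1}" if "S \<subseteq> {1..m}" for S
      using that by (auto simp: fun_eq_iff truncate_def parity_def split: if_splits)
    show "c = c'"
    proof
      fix b show "c b = c' b"
      proof (cases "b \<in> ?B")
        case True
        then obtain S where "b = monomial S" "S \<subseteq> {1..m}" by auto
        then show ?thesis
          using sym_ring_expand[of "c b"] sym_ring_expand[of "c' b"] eq c(1) c'(1) True
          by metis
      qed (use c(2) c'(2) in auto)
    qed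
  qed
  moreover have "?B \<subseteq> poly_space (Suc m)"
    using monomial_in poly_space_Suc by blast
  ultimately show ?thesis
    unfolding is_basis_def by simp
qed

lemma free_module_anti_ring: "free_module (sym_ring (Suc m)) (left_regular (anti_ring (Suc m)))"
  unfolding free_module_def using module_regular_module is_basis_monomials by blast

section \<open>Quotients by the kernel of a map\<close>

text \<open>Only additivity is assumed, because \<open>pre_tensor\<close> need not be a ring;
  products and scalars are treated lemma by lemma. The two instances are \<open>head_part\<close>
  for the quotient and \<open>poly_of\<close> for the tensor product.\<close>

locale kernel_quotient =
  fixes A :: "(rat, 'a, 'm) module_scheme" and \<phi> :: "'a \<Rightarrow> 'c::ab_group_add"
  assumes abelian_group: "abelian_group A"
    and map_add: "x \<in> carrier A \<Longrightarrow> y \<in> carrier A \<Longrightarrow> \<phi> (x \<oplus>\<^bsub>A\<^esub> y) = \<phi> x + \<phi> y"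
begin

sublocale abelian_group A by (rule abelian_group)

definition fibre :: "'c \<Rightarrow> 'a set" where
  "fibre r = {x \<in> carrier A. \<phi> x = r}"

lemma coset_eq_fibre:
  assumes "x \<in> carrier A"
  shows "fibre 0 +>\<^bsub>A\<^esub> x = fibre (\<phi> x)"
proof (intro equalityI subsetI)
  fix y assume "y \<in> fibre 0 +>\<^bsub>A\<^esub> x"
  then show "y \<in> fibre (\<phi> x)"
    using assms by (auto simp: a_r_coset_def' fibre_def map_add)
next
  fix y assume y: "y \<in> fibre (\<phi> x)"
  then have yA: "y \<in> carrier A" and eq: "\<phi> y = \<phi> x" by (auto simp: fibre_def)
  have y_eq: "y = (y \<ominus>\<^bsub>A\<^esub> x) \<oplus>\<^bsub>A\<^esub> x"
    using yA assms by (simp add: a_minus_def a_assoc l_neg)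
  have "\<phi> (y \<ominus>\<^bsub>A\<^esub> x) + \<phi> x = \<phi> x"
    using map_add[of "y \<ominus>\<^bsub>A\<^esub> x" x] yA assms y_eq eq by simp
  then have "y \<ominus>\<^bsub>A\<^esub> x \<in> fibre 0"
    using yA assms by (simp add: fibre_def)
  then show "y \<in> fibre 0 +>\<^bsub>A\<^esub> x"
    using y_eq by (auto simp: a_r_coset_def')
qed

text \<open>Scalar multiplication and grading of a quotient are unions over all representatives.
  Here all these cosets coincide, and a nonempty fibre makes the union equal to one of them.\<close>

lemma Union_cosets:
  assumes "r \<in> \<phi> ` carrier A"
    and "\<And>x. x \<in> carrier A \<Longrightarrow> f x \<in> carrier A \<and> \<phi> (f x) = g (\<phi> x)"
  shows "(\<Union>x\<in>fibre r. fibre 0 +>\<^bsub>A\<^esub> f x) = fibre (g r)"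
proof -
  have "fibre 0 +>\<^bsub>A\<^esub> f x = fibre (g r)" if "x \<in> fibre r" for x
    using that assms(2)[of x] coset_eq_fibre[of "f x"] by (simp add: fibre_def[of r])
  moreover have "fibre r \<noteq> {}" using assms(1) by (auto simp: fibre_def)
  ultimately show ?thesis by auto
qed

lemma quot_carrier: "carrier (quot_alg A (fibre 0)) = fibre ` \<phi> ` carrier A"
  by (auto simp: quot_alg_def FactRing_def A_RCOSETS_def' coset_eq_fibre)

lemma quot_add:
  assumes "r \<in> \<phi> ` carrier A" "s \<in> \<phi> ` carrier A"
  shows "fibre r \<oplus>\<^bsub>quot_alg A (fibre 0)\<^esub> fibre s = fibre (r + s)"
proof -
  obtain x where x: "x \<in> carrier A" "\<phi> x = r" using assms(1) by auto
  have "fibre r <+>\<^bsub>A\<^esub> fibre s = fibre (r + s)"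
  proof (intro equalityI subsetI)
    fix z assume "z \<in> fibre r <+>\<^bsub>A\<^esub> fibre s"
    then show "z \<in> fibre (r + s)" by (auto simp: set_add_def' fibre_def map_add)
  next
    fix z assume z: "z \<in> fibre (r + s)"
    then have zA: "z \<in> carrier A" by (simp add: fibre_def)
    have eq: "z = x \<oplus>\<^bsub>A\<^esub> (z \<ominus>\<^bsub>A\<^esub> x)"
      using x(1) zA by (metis a_comm a_minus_def add.inv_closed add.m_assoc add.l_inv_ex l_neg
          minus_closed r_zero)
    then have "r + \<phi> (z \<ominus>\<^bsub>A\<^esub> x) = r + s"
      using map_add[of x "z \<ominus>\<^bsub>A\<^esub> x"] x zA z by (simp add: fibre_def)
    then have "z \<ominus>\<^bsub>A\<^esub> x \<in> fibre s"
      using x zA by (simp add: fibre_def)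
    moreover have "x \<in> fibre r" using x by (simp add: fibre_def)
    ultimately show "z \<in> fibre r <+>\<^bsub>A\<^esub> fibre s"
      using eq by (auto simp: set_add_def')
  qed
  then show ?thesis by (simp add: quot_alg_def FactRing_def)
qed

lemma quot_mult:
  assumes "r \<in> \<phi> ` carrier A" "s \<in> \<phi> ` carrier A"
    and "\<And>x y. x \<in> carrier A \<Longrightarrow> y \<in> carrier A
      \<Longrightarrow> x \<otimes>\<^bsub>A\<^esub> y \<in> carrier A \<and> \<phi> (x \<otimes>\<^bsub>A\<^esub> y) = f (\<phi> x) (\<phi> y)"
  shows "fibre r \<otimes>\<^bsub>quot_alg A (fibre 0)\<^esub> fibre s = fibre (f r s)"
proof -
  have "fibre 0 +>\<^bsub>A\<^esub> (x \<otimes>\<^bsub>A\<^esub> y) = fibre (f r s)" if "x \<in> fibre r" "y \<in> fibre s" for x y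
    using that assms(3)[of x y] coset_eq_fibre[of "x \<otimes>\<^bsub>A\<^esub> y"]
    by (simp add: fibre_def[of r] fibre_def[of s])
  moreover have "fibre r \<noteq> {}" "fibre s \<noteq> {}" using assms(1,2) by (auto simp: fibre_def)
  ultimately show ?thesis by (auto simp: quot_alg_def FactRing_def rcoset_mult_def)
qed

lemma quot_one:
  "\<one>\<^bsub>A\<^esub> \<in> carrier A \<Longrightarrow> \<one>\<^bsub>quot_alg A (fibre 0)\<^esub> = fibre (\<phi> \<one>\<^bsub>A\<^esub>)"
  by (simp add: quot_alg_def FactRing_def coset_eq_fibre)

lemma quot_zero: "\<zero>\<^bsub>quot_alg A (fibre 0)\<^esub> = fibre 0"
  by (simp add: quot_alg_def FactRing_def)

lemma quot_smult:
  assumes "r \<in> \<phi> ` carrier A"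
    and "\<And>x. x \<in> carrier A \<Longrightarrow> q \<odot>\<^bsub>A\<^esub> x \<in> carrier A \<and> \<phi> (q \<odot>\<^bsub>A\<^esub> x) = f (\<phi> x)"
  shows "q \<odot>\<^bsub>quot_alg A (fibre 0)\<^esub> fibre r = fibre (f r)"
  using Union_cosets[of r "\<lambda>x. q \<odot>\<^bsub>A\<^esub> x" f] assms by (simp add: quot_alg_def)

lemma inj_on_fibre: "inj_on fibre (\<phi> ` carrier A)"
  by (auto simp: inj_on_def fibre_def)

end

lemma graded_quot_simps:
  "carrier (graded_quot A I) = carrier (quot_alg A I)"
  "mult (graded_quot A I) = mult (quot_alg A I)"
  "one (graded_quot A I) = one (quot_alg A I)"
  "zero (graded_quot A I) = zero (quot_alg A I)"
  "add (graded_quot A I) = add (quot_alg A I)"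
  "smult (graded_quot A I) = smult (quot_alg A I)"
  "hcomp (graded_quot A I) d X = (\<Union>x\<in>X. I +>\<^bsub>A\<^esub> hcomp A d x)"
  by (simp_all add: graded_quot_def module.defs)

section \<open>Linear maps on free vector spaces\<close>

definition lin_ext :: "('k \<Rightarrow> anti_poly) \<Rightarrow> ('k \<Rightarrow>\<^sub>0 rat) \<Rightarrow> anti_poly" where
  "lin_ext f x = (\<Sum>k\<in>Poly_Mapping.keys x. Poly_Mapping.lookup x k *\<^sub>s f k)"

lemma lin_ext_superset:
  assumes "finite K" "Poly_Mapping.keys x \<subseteq> K"
  shows "lin_ext f x = (\<Sum>k\<in>K. Poly_Mapping.lookup x k *\<^sub>s f k)"
  unfolding lin_ext_def
  by (rule sum.mono_neutral_left) (use assms in \<open>auto simp: in_keys_iff scale_simps\<close>)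

lemma lin_ext_add: "lin_ext f (x + y) = lin_ext f x + lin_ext f y"
proof -
  let ?K = "Poly_Mapping.keys x \<union> Poly_Mapping.keys y"
  have "lin_ext f (x + y) = (\<Sum>k\<in>?K. Poly_Mapping.lookup (x + y) k *\<^sub>s f k)"
    by (rule lin_ext_superset) (auto simp: Poly_Mapping.keys_add)
  also have "\<dots> = lin_ext f x + lin_ext f y"
    by (simp add: lookup_add scale_simps sum.distrib lin_ext_superset[of ?K])
  finally show ?thesis .
qed

lemma lin_ext_zero [simp]: "lin_ext f 0 = 0"
  by (simp add: lin_ext_def)

lemma lin_ext_scale: "lin_ext f (free_scale q x) = q *\<^sub>s lin_ext f x"
proof -
  have "Poly_Mapping.keys (free_scale q x) \<subseteq> Poly_Mapping.keys x"
    by (auto simp: in_keys_iff lookup_free_scale)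
  then have "lin_ext f (free_scale q x)
      = (\<Sum>k\<in>Poly_Mapping.keys x. Poly_Mapping.lookup (free_scale q x) k *\<^sub>s f k)"
    by (intro lin_ext_superset) auto
  then show ?thesis
    by (simp add: lookup_free_scale scale_sum scale_simps lin_ext_def)
qed

lemma lin_ext_diff: "lin_ext f (x - y) = lin_ext f x - lin_ext f y"
  using lin_ext_add[of f "x - y" y] by simp

lemma lin_ext_sum: "lin_ext f (\<Sum>i\<in>I. g i) = (\<Sum>i\<in>I. lin_ext f (g i))"
  by (induction I rule: infinite_finite_induct) (simp_all add: lin_ext_add)

lemma lin_ext_single [simp]: "lin_ext f (Poly_Mapping.single k c) = c *\<^sub>s f k"
  by (simp add: lin_ext_def scale_simps)

lemma sum_single_lookup:
  "(\<Sum>k\<in>Poly_Mapping.keys x. Poly_Mapping.single k (Poly_Mapping.lookup x k)) = x"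
  by (rule poly_mapping_eqI)
    (auto simp: lookup_sum lookup_single when_def in_keys_iff sum.delta')

definition supported :: "'k set \<Rightarrow> ('k \<Rightarrow>\<^sub>0 rat) set" where
  "supported K = {x. Poly_Mapping.keys x \<subseteq> K}"

lemma supported_subspace: "free_space.subspace (supported K)"
proof (rule free_space.subspaceI)
  fix x y assume "x \<in> supported K" "y \<in> supported K"
  then show "x + y \<in> supported K"
    using Poly_Mapping.keys_add[of x y] by (auto simp: supported_def)
next
  fix q x assume "x \<in> supported K"
  then show "free_scale q x \<in> supported K"
    by (auto simp: supported_def in_keys_iff lookup_free_scale)
qed (simp add: supported_def)

lemma supported_single [simp]: "k \<in> K \<Longrightarrow> Poly_Mapping.single k c \<in> supported K"
  by (auto simp: supported_def)

section \<open>The tensor product\<close>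

locale tensor_splitting =
  fixes m :: nat
begin

abbreviation "R \<equiv> anti_ring (Suc m)"
abbreviation "F \<equiv> theta_sum (Suc m)"
abbreviation "S \<equiv> sym_ring (Suc m)"
abbreviation "Q \<equiv> graded_quot R (J_ideal (Suc m))"
abbreviation "T \<equiv> pre_tensor Q S"
abbreviation "rels \<equiv> free_space.span (bilinear_rels Q S)"

section \<open>The quotient and its canonical representatives\<close>

sublocale J: kernel_quotient R "head_part m"
proof (rule kernel_quotient.intro)
  show "abelian_group R" by (rule ring.is_abelian_group[OF ring_anti_ring])
qed simp

abbreviation cls :: "anti_poly \<Rightarrow> anti_poly set" where
  "cls \<equiv> J.fibre"

lemma J_eq: "J_ideal (Suc m) = cls 0"
  by (simp add: J_ideal_eq J.fibre_def)

lemma head_part_image: "head_part m ` poly_space (Suc m) = poly_space m"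
proof
  show "poly_space m \<subseteq> head_part m ` poly_space (Suc m)"
    by (metis head_part_poly_space image_eqI poly_space_Suc subsetI)
qed auto

lemma Q_simps:
  assumes "g \<in> poly_space m" "h \<in> poly_space m"
  shows "carrier Q = cls ` poly_space m" "cls g \<oplus>\<^bsub>Q\<^esub> cls h = cls (g + h)"
    "cls g \<otimes>\<^bsub>Q\<^esub> cls h = cls (g \<cdot> h)" "q \<odot>\<^bsub>Q\<^esub> cls g = cls (q *\<^sub>s g)"
    "hcomp Q d (cls g) = cls (hom_comp d g)" "\<one>\<^bsub>Q\<^esub> = cls \<one>\<^sub>\<theta>" "\<zero>\<^bsub>Q\<^esub> = cls 0"
proof -
  note mem = assms[folded head_part_image]
  show "carrier Q = cls ` poly_space m"
    using J.quot_carrier by (simp add: graded_quot_simps J_eq head_part_image)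
  show "cls g \<oplus>\<^bsub>Q\<^esub> cls h = cls (g + h)"
    using J.quot_add[of g h] mem by (simp add: graded_quot_simps J_eq)
  show "cls g \<otimes>\<^bsub>Q\<^esub> cls h = cls (g \<cdot> h)"
    using J.quot_mult[of g h "(\<cdot>)"] mem by (simp add: graded_quot_simps J_eq head_part_wedge)
  show "q \<odot>\<^bsub>Q\<^esub> cls g = cls (q *\<^sub>s g)"
    using J.quot_smult[of g q "(*\<^sub>s) q"] mem by (simp add: graded_quot_simps J_eq)
  show "hcomp Q d (cls g) = cls (hom_comp d g)"
    using J.Union_cosets[of g "hom_comp d" "hom_comp d"] mem by (simp add: graded_quot_simps J_eq head_part_hom_comp)
  show "\<one>\<^bsub>Q\<^esub> = cls \<one>\<^sub>\<theta>" "\<zero>\<^bsub>Q\<^esub> = cls 0"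
    using J.quot_one J.quot_zero head_part_poly_space[OF poly_space_closed(8)]
    by (simp_all add: graded_quot_simps J_eq)
qed

text \<open>The choice is harmless, as \<open>head_part\<close> is constant on each class.\<close>

definition rep :: "anti_poly set \<Rightarrow> anti_poly" where
  "rep X = head_part m (SOME x. x \<in> X)"

lemma rep_cls [simp]:
  assumes "g \<in> poly_space m"
  shows "rep (cls g) = g"
proof -
  have "g \<in> cls g" using assms poly_space_Suc by (simp add: J.fibre_def)
  then have "(SOME x. x \<in> cls g) \<in> cls g" by (rule someI[where P = "\<lambda>x. x \<in> cls g"])
  then show ?thesis by (simp add: rep_def J.fibre_def)
qed

lemma cls_eq_iff:
  "g \<in> poly_space m \<Longrightarrow> h \<in> poly_space m \<Longrightarrow> cls g = cls h \<longleftrightarrow> g = h"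
  by (metis rep_cls)

definition pure :: "anti_poly set \<times> anti_poly \<Rightarrow> anti_poly" where
  "pure = (\<lambda>(X, b). rep X \<cdot> b)"

abbreviation poly_of :: "(anti_poly set \<times> anti_poly \<Rightarrow>\<^sub>0 rat) \<Rightarrow> anti_poly" where
  "poly_of \<equiv> lin_ext pure"

abbreviation sg :: "anti_poly set \<Rightarrow> anti_poly \<Rightarrow> (anti_poly set \<times> anti_poly \<Rightarrow>\<^sub>0 rat)" where
  "sg X b \<equiv> Poly_Mapping.single (X, b) 1"

section \<open>The evaluation of formal tensors as polynomials\<close>

lemma T_simps:
  "carrier T = supported (carrier Q \<times> carrier S)" "add T = (+)" "zero T = 0" "smult T = free_scale"
  "\<one>\<^bsub>T\<^esub> = sg \<one>\<^bsub>Q\<^esub> \<one>\<^sub>\<theta>"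
  by (simp_all add: pre_tensor_def supported_def)

lemma carrier_Q: "carrier Q = cls ` poly_space m"
  by (rule Q_simps(1)[of 0 0]) simp_all

lemma pure_in: "X \<in> carrier Q \<Longrightarrow> b \<in> carrier S \<Longrightarrow> pure (X, b) \<in> poly_space (Suc m)"
  by (auto simp: carrier_Q pure_def poly_space_Suc dest: sym_ring_poly_space)

lemma poly_of_in: "x \<in> carrier T \<Longrightarrow> poly_of x \<in> poly_space (Suc m)"
  unfolding lin_ext_def
  by (rule poly_space_sum) (auto simp: T_simps supported_def subset_iff pure_in)

lemma bilinear_rels_poly_of: "x \<in> bilinear_rels Q S \<Longrightarrow> x \<in> carrier T \<and> poly_of x = 0"
proof -
  assume x: "x \<in> bilinear_rels Q S"
  have in_T: "sg X b \<in> carrier T" if "X \<in> carrier Q" "b \<in> carrier S" for X b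
    using that by (simp add: T_simps)
  note sub = free_space.subspace_diff[OF supported_subspace] free_space.subspace_scale[OF supported_subspace]
  have Q_closed: "X \<oplus>\<^bsub>Q\<^esub> Y \<in> carrier Q" "q \<odot>\<^bsub>Q\<^esub> X \<in> carrier Q"
    "rep (X \<oplus>\<^bsub>Q\<^esub> Y) = rep X + rep Y" "rep (q \<odot>\<^bsub>Q\<^esub> X) = q *\<^sub>s rep X"
    if "X \<in> carrier Q" "Y \<in> carrier Q" for X Y q
    using that by (auto simp: carrier_Q Q_simps)
  show ?thesis
    using x unfolding bilinear_rels_def
    by (elim UnE CollectE exE conjE)
      (auto simp: T_simps Q_closed sym_ring_closed sym_ring_scale lin_ext_diff lin_ext_scale pure_def
        wedge_add_left wedge_add_right scale_simps intro!: sub)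
qed

lemma rels_poly_of:
  assumes "x \<in> rels"
  shows "x \<in> carrier T" "poly_of x = 0"
proof -
  have "free_space.subspace {x \<in> carrier T. poly_of x = 0}"
    using supported_subspace[of "carrier Q \<times> carrier S"]
    by (auto simp: free_space.subspace_def T_simps lin_ext_add lin_ext_scale scale_simps)
  then have "rels \<subseteq> {x \<in> carrier T. poly_of x = 0}"
    using bilinear_rels_poly_of by (intro free_space.span_minimal) auto
  then show "x \<in> carrier T" "poly_of x = 0" using assms by auto
qed

text \<open>The normal form of the tensors evaluating to \<open>r\<close>. It is linear only modulo
  \<open>rels\<close>, since the free space has unrelated generators for a sum and for its
  summands.\<close>

definition nf :: "anti_poly \<Rightarrow> (anti_poly set \<times> anti_poly \<Rightarrow>\<^sub>0 rat)" where
  "nf r = sg (cls (head_part m r)) \<one>\<^sub>\<theta> + sg (cls (tail_part m r)) F"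

lemma nf_in: "r \<in> poly_space (Suc m) \<Longrightarrow> nf r \<in> carrier T"
  unfolding nf_def T_simps carrier_Q
  by (intro free_space.subspace_add[OF supported_subspace] supported_single) auto

lemma poly_of_nf: "r \<in> poly_space (Suc m) \<Longrightarrow> poly_of (nf r) = r"
  using head_tail[of r m] by (simp add: nf_def lin_ext_add pure_def scale_simps)
    (metis head_part_in wedge_unit_right)

section \<open>Reduction to normal form modulo bilinearity\<close>

lemma rels_add_left:
  assumes "g \<in> poly_space m" "h \<in> poly_space m" "b \<in> carrier S"
  shows "sg (cls (g + h)) b - sg (cls g) b - sg (cls h) b \<in> rels"
proof -
  have "sg (cls g \<oplus>\<^bsub>Q\<^esub> cls h) b - sg (cls g) b - sg (cls h) b \<in> bilinear_rels Q S"
    unfolding bilinear_rels_def using assms carrier_Q by blast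
  then show ?thesis using assms by (simp only: Q_simps) (rule free_space.span_base)
qed

lemma rels_scale_left:
  assumes "g \<in> poly_space m" "b \<in> carrier S"
  shows "sg (cls (q *\<^sub>s g)) b - free_scale q (sg (cls g) b) \<in> rels"
proof -
  have "sg (q \<odot>\<^bsub>Q\<^esub> cls g) b - free_scale q (sg (cls g) b) \<in> bilinear_rels Q S"
    unfolding bilinear_rels_def using assms carrier_Q by blast
  then show ?thesis using assms by (simp only: Q_simps) (rule free_space.span_base)
qed

lemma rels_add_right:
  assumes "g \<in> poly_space m" "b \<in> carrier S" "c \<in> carrier S"
  shows "sg (cls g) (b + c) - sg (cls g) b - sg (cls g) c \<in> rels"
proof -
  have "sg (cls g) (b \<oplus>\<^bsub>S\<^esub> c) - sg (cls g) b - sg (cls g) c \<in> bilinear_rels Q S"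
    unfolding bilinear_rels_def using assms carrier_Q by blast
  then show ?thesis by (simp only: sym_ring_simps) (rule free_space.span_base)
qed

lemma rels_scale_right:
  assumes "g \<in> poly_space m" "b \<in> carrier S"
  shows "sg (cls g) (q *\<^sub>s b) - free_scale q (sg (cls g) b) \<in> rels"
proof -
  have "sg (cls g) (q \<odot>\<^bsub>S\<^esub> b) - free_scale q (sg (cls g) b) \<in> bilinear_rels Q S"
    unfolding bilinear_rels_def using assms carrier_Q by blast
  then show ?thesis by (simp only: sym_ring_simps) (rule free_space.span_base)
qed

lemma nf_add:
  assumes "r \<in> poly_space (Suc m)" "s \<in> poly_space (Suc m)"
  shows "nf (r + s) - (nf r + nf s) \<in> rels"
proof -
  have "(sg (cls (head_part m r + head_part m s)) \<one>\<^sub>\<theta> - sg (cls (head_part m r)) \<one>\<^sub>\<theta>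
        - sg (cls (head_part m s)) \<one>\<^sub>\<theta>)
      + (sg (cls (tail_part m r + tail_part m s)) F - sg (cls (tail_part m r)) F
        - sg (cls (tail_part m s)) F) \<in> rels"
    using assms by (intro free_space.span_add rels_add_left) simp_all
  then show ?thesis by (simp add: nf_def algebra_simps)
qed

lemma nf_scale:
  assumes "r \<in> poly_space (Suc m)"
  shows "nf (q *\<^sub>s r) - free_scale q (nf r) \<in> rels"
proof -
  have "(sg (cls (q *\<^sub>s head_part m r)) \<one>\<^sub>\<theta> - free_scale q (sg (cls (head_part m r)) \<one>\<^sub>\<theta>))
      + (sg (cls (q *\<^sub>s tail_part m r)) F - free_scale q (sg (cls (tail_part m r)) F)) \<in> rels"
    using assms by (intro free_space.span_add rels_scale_left) simp_all
  then show ?thesis by (simp add: nf_def algebra_simps free_space.scale_right_distrib)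
qed

text \<open>\<open>nf 0\<close> is a sum of two generators over the zero class and not 0 itself;
  scaling by 0 puts it into the span.\<close>

lemma nf_zero: "nf 0 \<in> rels"
  using nf_scale[of 0 0] by (simp add: scale_simps)

lemma nf_pure:
  assumes "X \<in> carrier Q" "b \<in> carrier S"
  shows "sg X b - nf (pure (X, b)) \<in> rels"
proof -
  obtain g where g: "g \<in> poly_space m" "X = cls g" using assms(1) by (auto simp: carrier_Q)
  obtain a d where b: "b = a *\<^sub>s \<one>\<^sub>\<theta> + d *\<^sub>s F" using assms(2) by (rule sym_ringE)
  have "pure (X, b) = a *\<^sub>s g + d *\<^sub>s g \<cdot> F"
    using g by (simp add: pure_def b wedge_add_right)
  then have nf: "nf (pure (X, b)) = sg (cls (a *\<^sub>s g)) \<one>\<^sub>\<theta> + sg (cls (d *\<^sub>s g)) F"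
    using g by (simp add: nf_def scale_simps)
  \<comment> \<open>Telescoping: split \<open>b\<close> in the right factor, pull the scalars
    \<open>a\<close> and \<open>d\<close> out there, and push them into the left factor.\<close>
  have "(sg X b - sg X (a *\<^sub>s \<one>\<^sub>\<theta>) - sg X (d *\<^sub>s F))
      + (sg X (a *\<^sub>s \<one>\<^sub>\<theta>) - free_scale a (sg X \<one>\<^sub>\<theta>)) + (sg X (d *\<^sub>s F) - free_scale d (sg X F))
      - (sg (cls (a *\<^sub>s g)) \<one>\<^sub>\<theta> - free_scale a (sg X \<one>\<^sub>\<theta>))
      - (sg (cls (d *\<^sub>s g)) F - free_scale d (sg X F)) \<in> rels"
    unfolding b g(2)
    by (rule free_space.span_diff[OF free_space.span_diff[OF free_space.span_add[OF
          free_space.span_add[OF rels_add_right rels_scale_right] rels_scale_right]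
          rels_scale_left] rels_scale_left])
      (use g(1) in \<open>simp_all add: sym_ring_closed sym_ring_scale\<close>)
  then show ?thesis unfolding nf by (simp add: algebra_simps)
qed

lemma nf_poly_of:
  assumes "x \<in> carrier T"
  shows "x - nf (poly_of x) \<in> rels"
proof -
  \<comment> \<open>Index set and coefficients are decoupled from \<open>x\<close>, which allows
    induction on the set with fixed coefficients.\<close>
  have "(\<Sum>k\<in>K. free_scale (c k) (Poly_Mapping.single k 1)) - nf (\<Sum>k\<in>K. c k *\<^sub>s pure k) \<in> rels"
    if "finite K" "K \<subseteq> carrier Q \<times> carrier S" for K c
    using that
  proof (induction K rule: finite_induct)
    case empty
    then show ?case using free_space.span_neg[OF nf_zero] by simp
  next
    case (insert k K)
    let ?s = "\<Sum>k\<in>K. c k *\<^sub>s pure k"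
    obtain X b where k: "k = (X, b)" "X \<in> carrier Q" "b \<in> carrier S" using insert.prems by auto
    have pure: "pure k \<in> poly_space (Suc m)" using k pure_in by blast
    have s: "?s \<in> poly_space (Suc m)"
      using insert.prems by (intro poly_space_sum) (auto intro!: poly_space_closed pure_in)
    \<comment> \<open>The induction hypothesis, the reduction of one generator, and the failures of
      \<open>nf\<close> to be homogeneous and additive; their combination collapses to the
      claim.\<close>
    have "((\<Sum>k\<in>K. free_scale (c k) (Poly_Mapping.single k 1)) - nf ?s)
        + free_scale (c k) (Poly_Mapping.single k 1 - nf (pure k))
        - (nf (c k *\<^sub>s pure k) - free_scale (c k) (nf (pure k)))
        - (nf (c k *\<^sub>s pure k + ?s) - (nf (c k *\<^sub>s pure k) + nf ?s)) \<in> rels"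
    proof (intro free_space.span_diff[OF free_space.span_diff[OF free_space.span_add[OF _
          free_space.span_scale]]] nf_scale nf_add)
      show "(\<Sum>k\<in>K. free_scale (c k) (Poly_Mapping.single k 1)) - nf ?s \<in> rels"
        using insert by blast
      show "Poly_Mapping.single k 1 - nf (pure k) \<in> rels"
        using nf_pure[OF k(2,3)] k(1) by simp
    qed (use pure s in auto)
    then show ?case
      using insert.hyps by (simp add: algebra_simps free_space.scale_right_diff_distrib)
  qed
  from this[of "Poly_Mapping.keys x" "Poly_Mapping.lookup x"]
  have "(\<Sum>k\<in>Poly_Mapping.keys x. Poly_Mapping.single k (Poly_Mapping.lookup x k)) - nf (poly_of x) \<in> rels"
    using assms by (simp add: T_simps supported_def lin_ext_def free_scale_def)
  then show ?thesis by (simp add: sum_single_lookup)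
qed

text \<open>A tensor that evaluates to 0 is congruent to \<open>nf 0\<close>, which is itself a
  relation. This is the injectivity of the evaluation.\<close>

lemma rels_eq: "rels = {x \<in> carrier T. poly_of x = 0}"
proof (intro equalityI subsetI)
  fix x assume "x \<in> {x \<in> carrier T. poly_of x = 0}"
  then have "x - nf 0 + nf 0 \<in> rels"
    using nf_poly_of[of x] by (intro free_space.span_add nf_zero) auto
  then show "x \<in> rels" by simp
qed (use rels_poly_of in auto)

section \<open>Compatibility with the Koszul product\<close>

lemma hom_comp_sym_ring:
  assumes "b \<in> carrier S"
  shows "hom_comp d b \<in> carrier S"
proof -
  obtain x y where b: "b = x *\<^sub>s \<one>\<^sub>\<theta> + y *\<^sub>s F" using assms by (rule sym_ringE)
  have "hom_comp d b = (if d = 0 then x else 0) *\<^sub>s \<one>\<^sub>\<theta> + (if d = 1 then y else 0) *\<^sub>s F"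
    by (auto simp: b hom_comp_def unit_theta_sum_apply fun_eq_iff)
  then show ?thesis using unit_theta_sum_symmetric by metis
qed

lemma koszul_mult_poly_of:
  assumes "k \<in> carrier Q \<times> carrier S" "k' \<in> carrier Q \<times> carrier S"
  shows "koszul_mult Q S k k' \<in> carrier T"
    and "poly_of (koszul_mult Q S k k') = pure k \<cdot> pure k'"
proof -
  obtain g b where k: "k = (cls g, b)" and g: "g \<in> poly_space m" and b: "b \<in> carrier S"
    using assms(1) by (auto simp: carrier_Q)
  obtain g' b' where k': "k' = (cls g', b')" and g': "g' \<in> poly_space m" and b': "b' \<in> carrier S"
    using assms(2) by (auto simp: carrier_Q)
  \<comment> \<open>Since \<open>cls\<close> is injective on \<open>poly_space m\<close>, a
    component of the class vanishes exactly when that of \<open>g'\<close> does.\<close>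
  have eq: "koszul_mult Q S k k' = (\<Sum>i | hom_comp i g' \<noteq> 0. \<Sum>j | hom_comp j b \<noteq> 0.
      Poly_Mapping.single (cls (g \<cdot> hom_comp i g'), hom_comp j b \<cdot> b') ((-1) ^ (i * j)))"
    using g g' by (simp add: koszul_mult_def k k' Q_simps cls_eq_iff)
  show "koszul_mult Q S k k' \<in> carrier T"
    unfolding eq T_simps carrier_Q using g g' b b'
    by (intro free_space.subspace_sum[OF supported_subspace] supported_single)
      (auto simp: sym_ring_closed hom_comp_sym_ring)
  have "poly_of (koszul_mult Q S k k') = (\<Sum>i | hom_comp i g' \<noteq> 0. \<Sum>j | hom_comp j b \<noteq> 0.
      g \<cdot> (((-1) ^ (i * j)) *\<^sub>s (hom_comp i g' \<cdot> hom_comp j b)) \<cdot> b')"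
    unfolding eq lin_ext_sum using g g' by (simp add: pure_def wedge_assoc)
  \<comment> \<open>The Koszul sign is spent on restoring the order of the factors, after which the
    components sum up to \<open>b\<close> and \<open>g'\<close>.\<close>
  also have "\<dots> = (\<Sum>i | hom_comp i g' \<noteq> 0. \<Sum>j | hom_comp j b \<noteq> 0. g \<cdot> (hom_comp j b \<cdot> hom_comp i g') \<cdot> b')"
    by (simp only: hom_comp_wedge_commute[symmetric])
  also have "\<dots> = g \<cdot> ((\<Sum>j | hom_comp j b \<noteq> 0. hom_comp j b) \<cdot> (\<Sum>i | hom_comp i g' \<noteq> 0. hom_comp i g')) \<cdot> b'"
    by (simp only: wedge_sum_left wedge_sum_right)
  also have "\<dots> = g \<cdot> (b \<cdot> g') \<cdot> b'"
    using sum_hom_comp[OF g'] sum_hom_comp[OF sym_ring_poly_space[OF b]] by simp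
  finally show "poly_of (koszul_mult Q S k k') = pure k \<cdot> pure k'"
    using g g' by (simp add: k k' pure_def wedge_assoc)
qed

lemma T_mult_poly_of:
  assumes "x \<in> carrier T" "y \<in> carrier T"
  shows "x \<otimes>\<^bsub>T\<^esub> y \<in> carrier T \<and> poly_of (x \<otimes>\<^bsub>T\<^esub> y) = poly_of x \<cdot> poly_of y"
proof -
  have keys: "k \<in> carrier Q \<times> carrier S" if "k \<in> Poly_Mapping.keys x \<or> k \<in> Poly_Mapping.keys y" for k
    using that assms by (auto simp: T_simps supported_def)
  have eq: "x \<otimes>\<^bsub>T\<^esub> y = (\<Sum>p\<in>Poly_Mapping.keys x. \<Sum>p'\<in>Poly_Mapping.keys y.
       free_scale (Poly_Mapping.lookup x p * Poly_Mapping.lookup y p') (koszul_mult Q S p p'))"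
    by (simp add: pre_tensor_def)
  have "x \<otimes>\<^bsub>T\<^esub> y \<in> carrier T"
    unfolding eq unfolding T_simps
    by (intro free_space.subspace_sum[OF supported_subspace]
        free_space.subspace_scale[OF supported_subspace])
      (use koszul_mult_poly_of(1) keys in \<open>simp add: T_simps\<close>)
  moreover have "poly_of (x \<otimes>\<^bsub>T\<^esub> y) = (\<Sum>p\<in>Poly_Mapping.keys x. \<Sum>p'\<in>Poly_Mapping.keys y.
      (Poly_Mapping.lookup x p * Poly_Mapping.lookup y p') *\<^sub>s (pure p \<cdot> pure p'))"
    unfolding eq lin_ext_sum lin_ext_scale
    by (intro sum.cong refl arg_cong[where f = "\<lambda>u. _ *\<^sub>s u"] koszul_mult_poly_of(2) keys) auto
  moreover have "poly_of x \<cdot> poly_of y = (\<Sum>p\<in>Poly_Mapping.keys x. \<Sum>p'\<in>Poly_Mapping.keys y.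
      (Poly_Mapping.lookup x p * Poly_Mapping.lookup y p') *\<^sub>s (pure p \<cdot> pure p'))"
    unfolding lin_ext_def
    by (subst wedge_sum_left, intro sum.cong refl, subst wedge_sum_right)
      (simp add: scale_simps mult.commute)
  ultimately show ?thesis by simp
qed

sublocale tensor: kernel_quotient T poly_of
proof (rule kernel_quotient.intro)
  show "abelian_group T"
  proof (rule abelian_groupI)
    fix x assume "x \<in> carrier T"
    then have "- x \<in> carrier T"
      using free_space.subspace_neg[OF supported_subspace] by (simp add: T_simps)
    then show "\<exists>y\<in>carrier T. y \<oplus>\<^bsub>T\<^esub> x = \<zero>\<^bsub>T\<^esub>"
      by (auto simp: T_simps intro!: bexI[of _ "- x"])
  qed (use supported_subspace[of "carrier Q \<times> carrier S"] in
      \<open>auto simp: T_simps algebra_simps free_space.subspace_def\<close>)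
qed (simp add: T_simps lin_ext_add)

lemma tensor_eq: "Q \<otimes>\<^sub>\<rat> S = quot_alg T (tensor.fibre 0)"
  by (simp add: tensor_alg_def rels_eq tensor.fibre_def)

lemma poly_of_image: "poly_of ` carrier T = poly_space (Suc m)"
  using poly_of_in nf_in poly_of_nf by (metis image_eqI image_subsetI subsetI subset_antisym)

text \<open>This is the inverse of the evaluation: \<open>r\<close> goes to the set of all formal
  tensors with value \<open>r\<close>. Fibres over distinct values of the surjection
  \<open>poly_of\<close> are distinct, which gives bijectivity.\<close>

lemma fibre_iso: "tensor.fibre \<in> alg_iso R (Q \<otimes>\<^sub>\<rat> S)"
proof -
  have one: "\<one>\<^bsub>T\<^esub> \<in> carrier T" "poly_of \<one>\<^bsub>T\<^esub> = \<one>\<^sub>\<theta>"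
    using Q_simps(6)[of 0 0] wedge_unit_left[of "\<one>\<^sub>\<theta>" m]
    by (auto simp: T_simps carrier_Q pure_def scale_simps)
  have "tensor.fibre \<in> ring_hom R (Q \<otimes>\<^sub>\<rat> S)"
    unfolding tensor_eq
    using tensor.quot_carrier tensor.quot_add tensor.quot_mult[of _ _ "(\<cdot>)"] tensor.quot_one one
      T_mult_poly_of poly_of_image
    by (intro ring_hom_memI) (simp_all)
  moreover have "bij_betw tensor.fibre (carrier R) (carrier (Q \<otimes>\<^sub>\<rat> S))"
    unfolding tensor_eq tensor.quot_carrier bij_betw_def
    using tensor.inj_on_fibre by (simp add: poly_of_image)
  moreover have "tensor.fibre (q *\<^sub>s r) = q \<odot>\<^bsub>Q \<otimes>\<^sub>\<rat> S\<^esub> tensor.fibre r" if "r \<in> carrier R" for q r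
    unfolding tensor_eq
  proof (rule tensor.quot_smult[symmetric])
    show "r \<in> poly_of ` carrier T" using that by (simp add: poly_of_image)
  qed (use free_space.subspace_scale[OF supported_subspace] in \<open>simp add: T_simps lin_ext_scale\<close>)
  ultimately show ?thesis
    by (simp add: alg_iso_def ring_iso_def)
qed

end

theorem proposition2p5:
  fixes n :: nat
  assumes "n \<ge> 1"
  shows "anti_ring n \<cong>\<^sub>a graded_quot (anti_ring n) (J_ideal n) \<otimes>\<^sub>\<rat> sym_ring n
    \<and> free_module (sym_ring n) (left_regular (anti_ring n))"
proof -
  obtain m where "n = Suc m" using assms by (cases n) auto
  then show ?thesis
    using tensor_splitting.fibre_iso[of m] free_module_anti_ring[of m]
    by (auto simp: alg_isomorphic_def)
qed

end
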